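(* Let $r,s\in\mathbb{R}$ with $r\neq 0$ and $s>0$, and let $n\geq 2$ be an integer. Then: (i) the function $\mathcal{P}_n\ni A\mapsto\Lambda_{r,s}(A)[K,M]$ is convex for all $K\in\mathcal{I}_n$ and all $M\in\mathcal{P}_n$ if and only if $r=1$ and $s\geq\frac12$; (ii) it is never the case that the function $\mathcal{P}_n\ni A\mapsto\Lambda_{r,s}(A)[K,M]$ is concave for all $K\in\mathcal{I}_n$ and all $M\in\mathcal{P}_n$.
   Context: $\mathcal{M}_n$ is the set of complex $n\times n$ matrices, $\mathcal{P}_n\subseteq\mathcal{M}_n$ the subset of positive definite (Hermitian) matrices, and $\mathcal{I}_n\subseteq\mathcal{M}_n$ the subset of invertible matrices. For $r,s\in\mathbb{R}$, $A,M\in\mathcal{P}_n$ and $K\in\mathcal{I}_n$, define \[ \Lambda_{r,s}(A)[K,M]:=\operatorname{tr}\left[\left(K^*A^rMA^rK\right)^s\right], \] where real powers of positive definite matrices are taken via the functional calculus. *)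

theory Defs
  imports "HOL-Analysis.Analysis"
begin

definition mat_adjoint :: "complex^'n^'m \<Rightarrow> complex^'m^'n" where
  "mat_adjoint A = (\<chi> i j. cnj (A $ j $ i))"

definition hermitian_mat :: "complex^'n^'n \<Rightarrow> bool" where
  "hermitian_mat A \<longleftrightarrow> mat_adjoint A = A"

definition unitary_mat :: "complex^'n^'n \<Rightarrow> bool" where
  "unitary_mat U \<longleftrightarrow> mat_adjoint U ** U = mat 1 \<and> U ** mat_adjoint U = mat 1"

definition real_diag :: "('n \<Rightarrow> real) \<Rightarrow> complex^'n^'n" where
  "real_diag d = (\<chi> i j. if i = j then complex_of_real (d i) else 0)"

text \<open>The quadratic form of a Hermitian matrix is real valued, so taking its real part
  loses nothing.\<close>

definition pos_def_mats :: "(complex^'n^'n) set" where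
  "pos_def_mats = {A. hermitian_mat A \<and>
     (\<forall>x. x \<noteq> 0 \<longrightarrow> 0 < Re (\<Sum>i\<in>UNIV. cnj (x $ i) * (A *v x) $ i))}"

text \<open>Functional calculus of a Hermitian matrix: \<open>f(U diag(d) U\<^sup>*) = U diag(f \<circ> d) U\<^sup>*\<close> for
  unitary \<open>U\<close>. A diagonalization exists by the spectral theorem and the value does not depend on
  which one is used; for matrices that are not Hermitian the value is unspecified.\<close>

definition fun_calculus :: "(real \<Rightarrow> real) \<Rightarrow> complex^'n^'n \<Rightarrow> complex^'n^'n" where
  "fun_calculus f A = (THE B. \<exists>U d. unitary_mat U \<and>
     A = U ** real_diag d ** mat_adjoint U \<and>
     B = U ** real_diag (\<lambda>i. f (d i)) ** mat_adjoint U)"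

definition mat_powr :: "complex^'n^'n \<Rightarrow> real \<Rightarrow> complex^'n^'n" where
  "mat_powr A r = fun_calculus (\<lambda>x. x powr r) A"

text \<open>For invertible \<open>K\<close> and positive definite \<open>A\<close>, \<open>M\<close> the matrix under the outer power is positive
  definite, so its power is positive definite too and the trace is a real number;
  \<^term>\<open>Re\<close> only changes its type.\<close>

definition Lambda ::
  "real \<Rightarrow> real \<Rightarrow> complex^'n^'n \<Rightarrow> complex^'n^'n \<Rightarrow> complex^'n^'n \<Rightarrow> real" where
  "Lambda r s A K M =
     Re (trace (mat_powr (mat_adjoint K ** mat_powr A r ** M ** mat_powr A r ** K) s))"

end

theory Submission
  imports Defs
begin

text \<open>For \<open>r = 1\<close>, write \<open>M = L\<^sup>* L\<close> and \<open>X = L A K\<close>; then \<open>\<Lambda>\<close> is \<open>\<Sum> \<sigma>\<^sub>k(X)\<^sup>p\<close> with \<open>p = 2 s \<ge> 1\<close>. For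
  orthonormal bases \<open>u\<close>, \<open>v\<close> one has \<open>\<Sum> \<bar>\<langle>v\<^sub>k, X u\<^sub>k\<rangle>\<bar>\<^sup>p \<le> \<Sum> \<sigma>\<^sub>k(X)\<^sup>p\<close>, with equality for singular bases, so
  the right-hand side is a maximum of convex functions of \<open>X\<close>.

  Conversely, \<open>(tr X / n)\<^sup>s \<le> tr X\<^sup>s \<le> n (tr X)\<^sup>s\<close> for positive semidefinite \<open>X\<close>, so when \<open>K\<close> and \<open>M\<close>
  degenerate to rank one, \<open>\<Lambda>\<close> is comparable to \<open>\<bar>\<langle>f, A\<^sup>r e\<rangle>\<bar>\<close> to the power \<open>2 s\<close>. The constants lost do not
  matter in configurations where this vanishes at the dominating points (or grows too slowly) but
  not at the dominated one. Such configurations exist for concavity and, unless \<open>r = 1\<close>, for convexity; for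
  \<open>r = 1\<close> the restriction to scalar matrices gives \<open>2 s \<ge> 1\<close>.\<close>

section \<open>Spectral theorem\<close>

text \<open>Conjugate linear in the first argument. Its real part is the real inner product
  \<open>\<bullet>\<close>, which serves for quadratic forms and dimension counts.\<close>

definition cip :: "complex^'n \<Rightarrow> complex^'n \<Rightarrow> complex" where
  "cip x y = (\<Sum>i\<in>UNIV. cnj (x $ i) * y $ i)"

lemma mat_adjoint_nth [simp]: "mat_adjoint A $ i $ j = cnj (A $ j $ i)"
  by (simp add: mat_adjoint_def)

lemma real_diag_nth [simp]: "real_diag d $ i $ j = (if i = j then complex_of_real (d i) else 0)"
  by (simp add: real_diag_def)

lemma mat_adjoint_adjoint [simp]: "mat_adjoint (mat_adjoint A) = A"
  by (simp add: vec_eq_iff)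

lemma mat_adjoint_mult: "mat_adjoint (A ** B) = mat_adjoint B ** mat_adjoint A"
  by (simp add: vec_eq_iff matrix_matrix_mult_def mult.commute)

lemma mat_adjoint_mat_1 [simp]: "mat_adjoint (mat 1) = mat 1"
  by (simp add: vec_eq_iff mat_def)

lemma mat_adjoint_real_diag [simp]: "mat_adjoint (real_diag d) = real_diag d"
  by (simp add: vec_eq_iff)

lemma cip_commute: "cip y x = cnj (cip x y)"
  by (simp add: cip_def mult.commute)

lemma cip_add_right: "cip x (y + z) = cip x y + cip x z"
  by (simp add: cip_def algebra_simps sum.distrib)

lemma cip_zero_right [simp]: "cip x 0 = 0"
  by (simp add: cip_def)

lemma cip_scaleR_right: "cip x (c *\<^sub>R y) = c *\<^sub>R cip x y"
  by (simp add: cip_def scaleR_sum_right)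

lemma cip_scaleR_left: "cip (c *\<^sub>R x) y = c *\<^sub>R cip x y"
  by (simp add: cip_def scaleR_sum_right)

lemma cip_adjoint: "cip x (A *v y) = cip (mat_adjoint A *v x) y"
proof -
  have "cip x (A *v y) = (\<Sum>i\<in>UNIV. \<Sum>j\<in>UNIV. cnj (x $ i) * A $ i $ j * y $ j)"
    by (simp add: cip_def matrix_vector_mult_def sum_distrib_left mult.assoc)
  also have "\<dots> = (\<Sum>j\<in>UNIV. \<Sum>i\<in>UNIV. cnj (x $ i) * A $ i $ j * y $ j)"
    by (rule sum.swap)
  also have "\<dots> = cip (mat_adjoint A *v x) y"
    by (simp add: cip_def matrix_vector_mult_def sum_distrib_left mult_ac)
  finally show ?thesis .
qed

lemma Re_cip: "Re (cip x y) = x \<bullet> y"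
  by (simp add: cip_def inner_vec_def inner_complex_def)

text \<open>Complex orthogonality to \<open>x\<close> thus amounts to real orthogonality to both
  \<open>x\<close> and \<open>\<i> *s x\<close>.\<close>

lemma Im_cip: "Im (cip x y) = (\<i> *s x) \<bullet> y"
  by (simp add: cip_def inner_vec_def inner_complex_def algebra_simps)

lemma cip_self: "cip x x = complex_of_real ((norm x)\<^sup>2)"
proof -
  have "Im (cip x x) = 0" by (simp add: cip_def)
  moreover have "Re (cip x x) = (norm x)\<^sup>2" by (simp add: Re_cip power2_norm_eq_inner)
  ultimately show ?thesis by (simp add: complex_eq_iff)
qed

lemma scaleR_matrix_vector: "(c *\<^sub>R A) *v x = c *\<^sub>R (A *v (x::complex^'n))"
  by (simp add: matrix_vector_mult_def vec_eq_iff scaleR_sum_right)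

lemma matrix_vector_scaleR: "A *v (c *\<^sub>R x) = c *\<^sub>R (A *v (x::complex^'n))"
  by (simp add: matrix_vector_mult_def vec_eq_iff scaleR_sum_right)

lemma hermitian_inner: "hermitian_mat A \<Longrightarrow> x \<bullet> (A *v y) = (A *v x) \<bullet> y"
  by (metis Re_cip cip_adjoint hermitian_mat_def)

lemma continuous_on_matrix_vector [continuous_intros]:
  fixes A :: "complex^'n^'m"
  assumes "continuous_on S f"
  shows "continuous_on S (\<lambda>x. A *v f x)"
  unfolding matrix_vector_mult_def
  by (intro continuous_intros assms continuous_on_vec_lambda)

text \<open>The orthogonal complement of eigenvectors is invariant under \<open>A\<close>. A
  maximizer of the quadratic form on its unit sphere is an eigenvector, because the residual
  \<open>A *v x - c *\<^sub>R x\<close> is itself an admissible direction of variation.\<close>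

lemma hermitian_eigenvector_orthogonal:
  fixes A :: "complex^'n^'n"
  assumes A: "hermitian_mat A" and fin: "finite F" and card: "card F < CARD('n)"
    and F: "\<And>v. v \<in> F \<Longrightarrow> \<exists>c. A *v v = c *\<^sub>R v"
  obtains x c where "norm x = 1" "\<And>v. v \<in> F \<Longrightarrow> cip v x = 0" "A *v x = c *\<^sub>R x"
proof -
  define W where "W = {x. \<forall>v\<in>F. cip v x = 0}"
  have Wscale: "c *\<^sub>R x \<in> W" if "x \<in> W" for c x
    using that by (simp add: W_def cip_scaleR_right)
  have Wadd: "x + y \<in> W" if "x \<in> W" "y \<in> W" for x y
    using that by (simp add: W_def cip_add_right)
  have WA: "A *v x \<in> W" if "x \<in> W" for x
  proof -
    have "cip v (A *v x) = 0" if v: "v \<in> F" for v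
    proof -
      obtain c where c: "A *v v = c *\<^sub>R v" using F[OF v] by blast
      have "cip v (A *v x) = cip (A *v v) x" using A by (simp add: cip_adjoint hermitian_mat_def)
      then show ?thesis using c v \<open>x \<in> W\<close> by (simp add: W_def cip_scaleR_left)
    qed
    then show ?thesis by (simp add: W_def)
  qed
  \<comment> \<open>The real span of \<open>G\<close> has dimension at most
    \<open>2 * card F\<close>, below the real dimension \<open>2 * CARD('n)\<close> of the space. So
    some nonzero vector is real orthogonal to \<open>G\<close>, hence complex orthogonal to
    \<open>F\<close>.\<close>
  define G where "G = F \<union> (\<lambda>v. \<i> *s v) ` F"
  have "dim (span G) \<le> card G" using fin by (simp add: G_def dim_le_card')
  also have "\<dots> \<le> card F + card F"
    unfolding G_def by (meson add_le_mono card_Un_le card_image_le dual_order.trans fin order_refl)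
  also have "\<dots> < DIM(complex^'n)" using card by simp
  finally obtain z where z: "z \<noteq> 0" "\<And>y. y \<in> span G \<Longrightarrow> orthogonal z y"
    using orthogonal_to_subspace_exists by (metis dim_span)
  have zW: "z \<in> W"
  proof -
    have "cip v z = 0" if "v \<in> F" for v
    proof -
      have "v \<in> span G" "\<i> *s v \<in> span G" using that by (auto simp: G_def intro: span_base)
      then have "v \<bullet> z = 0" "(\<i> *s v) \<bullet> z = 0" using z(2) by (metis orthogonal_def inner_commute)+
      then show ?thesis by (simp add: complex_eq_iff Re_cip Im_cip)
    qed
    then show ?thesis by (simp add: W_def)
  qed
  have "closed W"
  proof -
    have "W = (\<Inter>v\<in>F. {x. cip v x = 0})" by (auto simp: W_def)
    moreover have "closed {x. cip v x = 0}" for v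
      unfolding cip_def by (intro closed_Collect_eq continuous_intros)
    ultimately show ?thesis by auto
  qed
  then have cpt: "compact (W \<inter> sphere 0 1)" by (simp add: closed_Int_compact)
  have ne: "W \<inter> sphere 0 1 \<noteq> {}"
  proof -
    have "(1 / norm z) *\<^sub>R z \<in> W \<inter> sphere 0 1" using zW z by (simp add: Wscale)
    then show ?thesis by blast
  qed
  have "continuous_on (W \<inter> sphere 0 1) (\<lambda>x. x \<bullet> (A *v x))"
    by (intro continuous_intros)
  from continuous_attains_sup[OF cpt ne this]
  obtain x where x: "x \<in> W" "norm x = 1"
    and max: "\<And>y. y \<in> W \<Longrightarrow> norm y = 1 \<Longrightarrow> y \<bullet> (A *v y) \<le> x \<bullet> (A *v x)" by auto
  define c where "c = x \<bullet> (A *v x)"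
  have maxW: "y \<bullet> (A *v y) \<le> c * (y \<bullet> y)" if "y \<in> W" for y
  proof (cases "y = 0")
    case False
    have "((1 / norm y) *\<^sub>R y) \<bullet> (A *v ((1 / norm y) *\<^sub>R y)) \<le> c"
      unfolding c_def by (rule max) (use that False in \<open>auto simp: Wscale\<close>)
    then have "(y \<bullet> (A *v y)) / (norm y * norm y) \<le> c"
      by (simp add: matrix_vector_scaleR)
    then show ?thesis using False by (simp add: divide_le_eq power2_norm_eq_inner[symmetric] power2_eq_square)
  qed simp
  define y where "y = A *v x - c *\<^sub>R x"
  have yW: "y \<in> W"
    using Wadd[OF WA[OF x(1)] Wscale[OF x(1), of "-c"]] by (simp add: y_def)
  define Q where "Q = c * (y \<bullet> y) - y \<bullet> (A *v y)"
  have xx: "x \<bullet> x = 1" using x(2) by (simp add: power2_norm_eq_inner[symmetric])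
  have yy: "y \<bullet> (A *v x) - c * (x \<bullet> y) = y \<bullet> y"
    by (subst (4) y_def) (simp add: inner_diff_right inner_commute)
  \<comment> \<open>Moving from the maximizer \<open>x\<close> along \<open>y\<close> changes the
    form minus \<open>c\<close> times the squared norm by \<open>2 * t * (y \<bullet> y)\<close> to
    first order in \<open>t\<close>. As the change cannot be positive, letting \<open>t\<close> tend
    to 0 forces \<open>y = 0\<close>.\<close>
  have small: "2 * (y \<bullet> y) \<le> t * Q" if "t > 0" for t
  proof -
    have "(x + t *\<^sub>R y) \<bullet> (A *v (x + t *\<^sub>R y)) \<le> c * ((x + t *\<^sub>R y) \<bullet> (x + t *\<^sub>R y))"
      by (intro maxW Wadd Wscale x yW)
    moreover have "x \<bullet> (A *v y) = y \<bullet> (A *v x)"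
      using hermitian_inner[OF A] by (metis inner_commute)
    ultimately have "c + 2 * t * (y \<bullet> (A *v x)) + t * t * (y \<bullet> (A *v y))
        \<le> c * (1 + 2 * t * (x \<bullet> y) + t * t * (y \<bullet> y))"
      using xx by (simp add: matrix_vector_right_distrib matrix_vector_scaleR inner_add_left
          inner_add_right inner_commute c_def[symmetric] algebra_simps)
    then have "t * (2 * (y \<bullet> (A *v x) - c * (x \<bullet> y))) \<le> t * (t * Q)"
      by (simp add: Q_def algebra_simps)
    then show ?thesis using that yy by simp
  qed
  have "((\<lambda>t. t * Q) \<longlongrightarrow> 0 * Q) (at_right 0)" by (intro tendsto_intros)
  moreover have "eventually (\<lambda>t. 2 * (y \<bullet> y) \<le> t * Q) (at_right (0::real))"
    using small by (auto simp: eventually_at_filter)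
  ultimately have "2 * (y \<bullet> y) \<le> 0 * Q"
    by (intro tendsto_lowerbound) auto
  then have "y = 0" using inner_ge_zero[of y] by (metis dual_order.antisym inner_eq_zero_iff mult_zero_left mult_le_0_iff not_numeral_le_zero)
  then have "A *v x = c *\<^sub>R x" by (simp add: y_def)
  with x that show thesis by (auto simp: W_def)
qed

text \<open>Eigenvectors are found one index at a time, each orthogonal to the earlier ones;
  induction over index sets \<open>S\<close> yields a family labelled by \<open>'n\<close>, ready to
  form the columns of a matrix.\<close>

lemma hermitian_eigenbasis:
  fixes A :: "complex^'n^'n"
  assumes A: "hermitian_mat A"
  shows "\<exists>b d. (\<forall>i j. cip (b i) (b j) = (if i = j then 1 else 0)) \<and> (\<forall>i::'n. A *v b i = d i *\<^sub>R b i)"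
proof -
  have "\<exists>b d. (\<forall>i\<in>S. \<forall>j\<in>S. cip (b i) (b j) = (if i = j then 1 else 0))
      \<and> (\<forall>i\<in>S. A *v b i = d i *\<^sub>R b i)" for S :: "'n set"
    using finite[of S]
  proof (induction S rule: finite_induct)
    case (insert k S)
    then obtain b d where b: "\<forall>i\<in>S. \<forall>j\<in>S. cip (b i) (b j) = (if i = j then 1 else 0)"
        "\<forall>i\<in>S. A *v b i = d i *\<^sub>R b i" by auto
    have "card (b ` S) \<le> card S" by (simp add: card_image_le)
    also have "\<dots> < CARD('n)" using insert.hyps by (metis finite_code psubset_card_mono UNIV_I top.not_eq_extremum)
    finally have cd: "card (b ` S) < CARD('n)" .
    obtain x c where x: "norm x = 1" "\<And>v. v \<in> b ` S \<Longrightarrow> cip v x = 0" "A *v x = c *\<^sub>R x"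
      by (rule hermitian_eigenvector_orthogonal[OF A _ cd]) (use b in auto)
    have "cip x v = 0" if "v \<in> b ` S" for v using x(2)[OF that] by (simp add: cip_commute[of x v])
    moreover have "cip x x = 1" by (simp add: cip_self x)
    ultimately show ?case using b x insert.hyps
      by (intro exI[of _ "b(k := x)"] exI[of _ "d(k := c)"]) auto
  qed auto
  from this[of UNIV] show ?thesis by simp
qed

lemma unitary_matI: "mat_adjoint U ** U = mat 1 \<Longrightarrow> unitary_mat U"
  by (simp add: unitary_mat_def matrix_left_right_inverse)

theorem hermitian_diagonalization:
  fixes A :: "complex^'n^'n"
  assumes A: "hermitian_mat A"
  obtains U d where "unitary_mat U" "A = U ** real_diag d ** mat_adjoint U"
proof -
  obtain b d where b: "\<And>i j. cip (b i) (b j) = (if i = j then 1 else 0)"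
    "\<And>i::'n. A *v b i = d i *\<^sub>R b i" using hermitian_eigenbasis[OF A] by blast
  define U :: "complex^'n^'n" where "U = (\<chi> i j. b j $ i)"
  have "mat_adjoint U ** U = mat 1"
    using b(1) by (simp add: vec_eq_iff matrix_matrix_mult_def U_def mat_def cip_def)
  then have U: "unitary_mat U" by (rule unitary_matI)
  have "A ** U = U ** real_diag d"
  proof -
    have "(A ** U) $ i $ j = (U ** real_diag d) $ i $ j" for i j
    proof -
      have "(A ** U) $ i $ j = (A *v b j) $ i"
        by (simp add: matrix_matrix_mult_def matrix_vector_mult_def U_def)
      also have "\<dots> = of_real (d j) * b j $ i"
        unfolding b(2) vector_scaleR_component by (rule scaleR_conv_of_real)
      also have "\<dots> = (U ** real_diag d) $ i $ j"
        by (simp add: matrix_matrix_mult_def U_def if_distrib[of "\<lambda>x. _ * x"] cong: if_cong)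
      finally show ?thesis .
    qed
    then show ?thesis by (simp add: vec_eq_iff)
  qed
  then have "A = U ** real_diag d ** mat_adjoint U"
    using U by (metis matrix_mul_assoc matrix_mul_rid unitary_mat_def)
  then show thesis using U that by blast
qed

section \<open>Functional calculus\<close>

lemma unitary_matD:
  assumes "unitary_mat U"
  shows "mat_adjoint U ** U = mat 1" "U ** mat_adjoint U = mat 1"
  using assms by (auto simp: unitary_mat_def)

lemma real_diag_matrix_mult_nth: "(real_diag d ** W) $ i $ j = of_real (d i) * W $ i $ j"
  by (simp add: matrix_matrix_mult_def if_distrib[of "\<lambda>x. x * _"] cong: if_cong)

lemma matrix_real_diag_mult_nth: "(W ** real_diag d) $ i $ j = W $ i $ j * of_real (d j)"
  by (simp add: matrix_matrix_mult_def if_distrib[of "\<lambda>x. _ * x"] cong: if_cong)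

lemma unitary_cancel:
  assumes "unitary_mat U"
  shows "W ** mat_adjoint U ** U = W" "W ** U ** mat_adjoint U = W"
  using unitary_matD[OF assms] by (simp_all flip: matrix_mul_assoc)

lemma unitary_conjugate:
  assumes "unitary_mat U"
  shows "mat_adjoint U ** (U ** B ** mat_adjoint U) ** U = B"
  by (simp add: matrix_mul_assoc unitary_cancel[OF assms] unitary_matD[OF assms])

text \<open>Two diagonalizations are intertwined by \<open>W = V\<^sup>* U\<close>, whose entry \<open>(i, j)\<close> vanishes unless the
  eigenvalues \<open>e i\<close> and \<open>d j\<close> agree; hence \<open>W\<close> also intertwines the images under \<open>f\<close>.\<close>

lemma fun_calculus_eq:
  assumes U: "unitary_mat U" and A: "A = U ** real_diag d ** mat_adjoint U"
  shows "fun_calculus f A = U ** real_diag (\<lambda>i. f (d i)) ** mat_adjoint U"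
  unfolding fun_calculus_def
proof (rule the_equality)
  show "\<exists>V e. unitary_mat V \<and> A = V ** real_diag e ** mat_adjoint V \<and>
      U ** real_diag (\<lambda>i. f (d i)) ** mat_adjoint U = V ** real_diag (\<lambda>i. f (e i)) ** mat_adjoint V"
    using assms by blast
next
  fix B assume "\<exists>V e. unitary_mat V \<and> A = V ** real_diag e ** mat_adjoint V \<and>
      B = V ** real_diag (\<lambda>i. f (e i)) ** mat_adjoint V"
  then obtain V e where V: "unitary_mat V" "A = V ** real_diag e ** mat_adjoint V"
    and B: "B = V ** real_diag (\<lambda>i. f (e i)) ** mat_adjoint V" by blast
  define W where "W = mat_adjoint V ** U"
  have "W ** real_diag d = mat_adjoint V ** A ** U"
    unfolding W_def A by (simp add: matrix_mul_assoc unitary_cancel[OF U])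
  also have "\<dots> = real_diag e ** W"
    unfolding W_def V(2) by (simp add: matrix_mul_assoc unitary_matD[OF V(1)])
  finally have "W $ i $ j * of_real (d j) = of_real (e i) * W $ i $ j" for i j
    by (metis real_diag_matrix_mult_nth matrix_real_diag_mult_nth)
  then have "W $ i $ j = 0 \<or> d j = e i" for i j
    by (metis mult.commute mult_cancel_right of_real_eq_iff)
  then have "W ** real_diag (\<lambda>i. f (d i)) = real_diag (\<lambda>i. f (e i)) ** W"
    unfolding vec_eq_iff matrix_real_diag_mult_nth real_diag_matrix_mult_nth
    by (metis mult.commute mult_zero_left)
  then have "V ** (W ** real_diag (\<lambda>i. f (d i))) ** mat_adjoint U
      = V ** (real_diag (\<lambda>i. f (e i)) ** W) ** mat_adjoint U" by simp
  then show "B = U ** real_diag (\<lambda>i. f (d i)) ** mat_adjoint U"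
    by (simp add: W_def B matrix_mul_assoc unitary_cancel[OF U] unitary_matD[OF V(1)])
qed

lemma trace_unitary_conjugate:
  assumes "unitary_mat U"
  shows "Re (trace (U ** real_diag d ** mat_adjoint U)) = (\<Sum>i\<in>UNIV. d i)"
proof -
  have "trace (U ** real_diag d ** mat_adjoint U) = trace (real_diag d)"
    by (metis assms matrix_mul_assoc matrix_mul_lid trace_mul_sym unitary_matD(1))
  then show ?thesis by (simp add: trace_def)
qed

lemma fun_calculus_hermitian:
  assumes "hermitian_mat A"
  shows "hermitian_mat (fun_calculus f A)"
proof -
  obtain U d where "unitary_mat U" "A = U ** real_diag d ** mat_adjoint U"
    using hermitian_diagonalization[OF assms] .
  then show ?thesis
    by (simp add: fun_calculus_eq hermitian_mat_def mat_adjoint_mult matrix_mul_assoc)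
qed

lemma fun_calculus_real_diag: "fun_calculus f (real_diag d) = real_diag (\<lambda>i. f (d i))"
  using fun_calculus_eq[of "mat 1" "real_diag d" d f] by (simp add: unitary_mat_def)

section \<open>Functions of a projection and its complement\<close>

lemma matrix_mult_add_left: "(A + B) ** C = A ** C + B ** (C::complex^'n^'m)"
  by (simp add: vec_eq_iff matrix_matrix_mult_def distrib_right sum.distrib)

lemma matrix_mult_diff_left: "(A - B) ** C = A ** C - B ** (C::complex^'n^'m)"
  by (simp add: vec_eq_iff matrix_matrix_mult_def left_diff_distrib sum_subtractf)

lemma matrix_mult_diff_right: "A ** (B - C) = A ** B - A ** (C::complex^'n^'m)"
  by (simp add: vec_eq_iff matrix_matrix_mult_def right_diff_distrib sum_subtractf)

lemma matrix_mult_scaleR_left: "(c *\<^sub>R A) ** B = c *\<^sub>R (A ** (B::complex^'n^'m))"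
  by (simp add: vec_eq_iff matrix_matrix_mult_def scaleR_sum_right)

lemma matrix_mult_scaleR_right: "A ** (c *\<^sub>R B) = c *\<^sub>R (A ** (B::complex^'n^'m))"
  by (simp add: vec_eq_iff matrix_matrix_mult_def scaleR_sum_right)

lemmas matrix_mult_linear =
  matrix_mult_diff_left matrix_mult_diff_right matrix_mult_scaleR_left matrix_mult_scaleR_right
  matrix_add_ldistrib matrix_mult_add_left

lemma mat_adjoint_linear:
  "mat_adjoint (A + B) = mat_adjoint A + mat_adjoint B"
  "mat_adjoint (A - B) = mat_adjoint A - mat_adjoint B"
  "mat_adjoint (c *\<^sub>R A) = c *\<^sub>R mat_adjoint A"
  by (simp_all add: vec_eq_iff)

text \<open>The eigenvalues \<open>d i\<close> of a projection are 0 or 1, so a diagonalization of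
  \<open>P\<close> also diagonalizes the combination, with eigenvalues \<open>a\<close> and
  \<open>b\<close>.\<close>

lemma fun_calculus_projection:
  assumes P: "hermitian_mat P" "P ** P = P"
  shows "fun_calculus f (a *\<^sub>R P + b *\<^sub>R (mat 1 - P)) = f a *\<^sub>R P + f b *\<^sub>R (mat 1 - P)"
proof -
  obtain U d where U: "unitary_mat U" and Pd: "P = U ** real_diag d ** mat_adjoint U"
    using hermitian_diagonalization[OF P(1)] .
  have "real_diag d ** real_diag d = real_diag d"
    using P(2) unfolding Pd
    by (metis U matrix_mul_assoc matrix_mul_lid matrix_mul_rid unitary_matD(1))
  then have "of_real (d i) * of_real (d i) = complex_of_real (d i)" for i
    by (metis real_diag_nth real_diag_matrix_mult_nth)
  then have d: "d i = 0 \<or> d i = 1" for i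
    by (metis mult_cancel_left2 of_real_eq_0_iff of_real_eq_1_iff)
  have I: "mat 1 = U ** real_diag (\<lambda>_. 1) ** mat_adjoint U"
  proof -
    have "(real_diag (\<lambda>_. 1) :: complex^'a^'a) = mat 1" by (simp add: vec_eq_iff mat_def)
    then show ?thesis using unitary_matD(2)[OF U] by (simp only: matrix_mul_rid)
  qed
  have *: "u *\<^sub>R P + v *\<^sub>R (mat 1 - P) = U ** real_diag (\<lambda>i. u * d i + v * (1 - d i)) ** mat_adjoint U" for u v
  proof -
    have "real_diag (\<lambda>i. u * d i + v * (1 - d i)) = u *\<^sub>R real_diag d + v *\<^sub>R (real_diag (\<lambda>_. 1) - real_diag d)"
      unfolding vec_eq_iff vector_add_component vector_minus_component vector_scaleR_component
      by (simp add: scaleR_conv_of_real)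
    then show ?thesis by (simp only: I Pd matrix_mult_linear)
  qed
  have "f (a * d i + b * (1 - d i)) = f a * d i + f b * (1 - d i)" for i
    using d[of i] by auto
  then show ?thesis unfolding * fun_calculus_eq[OF U refl] by simp
qed

section \<open>Positive definite matrices and trace bounds\<close>

lemma pos_def_mats_iff:
  "A \<in> pos_def_mats \<longleftrightarrow> hermitian_mat A \<and> (\<forall>x. x \<noteq> 0 \<longrightarrow> 0 < x \<bullet> (A *v x))"
  by (simp add: pos_def_mats_def cip_def[symmetric] Re_cip)

lemma pos_def_hermitian: "A \<in> pos_def_mats \<Longrightarrow> hermitian_mat A"
  by (simp add: pos_def_mats_iff)

lemma inner_congruence: "x \<bullet> ((mat_adjoint B ** M ** B) *v x) = (B *v x) \<bullet> (M *v (B *v x))"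
  using cip_adjoint[of x "mat_adjoint B" "M *v (B *v x)"]
  by (simp add: matrix_vector_mul_assoc matrix_mul_assoc flip: Re_cip)

lemma real_diag_axis: "axis i 1 \<bullet> (real_diag d *v axis i 1) = d i"
proof -
  have "axis i 1 \<bullet> (real_diag d *v axis i 1) = inner 1 ((real_diag d *v axis i 1) $ i)"
    by (rule inner_axis')
  also have "\<dots> = d i"
    by (simp add: matrix_vector_mul_component matrix_vector_mult_def axis_def if_distrib cong: if_cong)
  finally show ?thesis .
qed

text \<open>The column \<open>U *v axis i 1\<close> is a unit eigenvector, so positivity of the
  quadratic form passes to the eigenvalues.\<close>

lemma eigenvalue_inner:
  assumes U: "unitary_mat U" and A: "A = U ** real_diag d ** mat_adjoint U"
  shows "d i = (U *v axis i 1) \<bullet> (A *v (U *v axis i 1))"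
proof -
  have "mat_adjoint U ** A ** U = real_diag d" unfolding A using unitary_conjugate[OF U] .
  then show ?thesis by (metis inner_congruence real_diag_axis)
qed

lemma unitary_axis_nonzero:
  assumes "unitary_mat U"
  shows "U *v axis i 1 \<noteq> 0"
proof
  assume "U *v axis i 1 = 0"
  then have "mat_adjoint U *v (U *v axis i 1) = 0" by simp
  then show False by (simp add: matrix_vector_mul_assoc unitary_matD[OF assms] axis_eq_0_iff)
qed

lemma pos_def_eigenvalue:
  assumes "A \<in> pos_def_mats" "unitary_mat U" "A = U ** real_diag d ** mat_adjoint U"
  shows "0 < d i"
  using assms eigenvalue_inner[OF assms(2,3)] unitary_axis_nonzero[OF assms(2)]
  by (simp add: pos_def_mats_iff)

lemma mat_powr_1: "A \<in> pos_def_mats \<Longrightarrow> mat_powr A 1 = A"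
proof -
  assume A: "A \<in> pos_def_mats"
  obtain U d where U: "unitary_mat U" "A = U ** real_diag d ** mat_adjoint U"
    using hermitian_diagonalization[OF pos_def_hermitian[OF A]] .
  have "d i powr 1 = d i" for i using pos_def_eigenvalue[OF A U, of i] by simp
  then show ?thesis unfolding mat_powr_def fun_calculus_eq[OF U] using U by simp
qed

text \<open>Some eigenvalue is at least the mean \<open>Re (trace X) / CARD('n)\<close>, and each is
  at most the trace because all are nonnegative. Only monotonicity of the power enters, so
  \<open>s\<close> may lie on either side of 1.\<close>

lemma trace_mat_powr_bounds:
  fixes X :: "complex^'n^'n"
  assumes X: "hermitian_mat X" "\<And>x. 0 \<le> x \<bullet> (X *v x)" and s: "s > 0"
  shows "(Re (trace X) / CARD('n)) powr s \<le> Re (trace (mat_powr X s))"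
    "Re (trace (mat_powr X s)) \<le> CARD('n) * Re (trace X) powr s"
    "0 \<le> Re (trace X)"
proof -
  obtain U d where U: "unitary_mat U" "X = U ** real_diag d ** mat_adjoint U"
    using hermitian_diagonalization[OF X(1)] .
  have d: "0 \<le> d i" for i using eigenvalue_inner[OF U] X(2) by metis
  have T: "Re (trace X) = (\<Sum>i\<in>UNIV. d i)"
    by (simp add: U trace_unitary_conjugate)
  have Ts: "Re (trace (mat_powr X s)) = (\<Sum>i\<in>UNIV. d i powr s)"
    unfolding mat_powr_def fun_calculus_eq[OF U] by (rule trace_unitary_conjugate[OF U(1)])
  show "0 \<le> Re (trace X)" by (simp add: T d sum_nonneg)
  have "\<exists>i. Re (trace X) / CARD('n) \<le> d i"
  proof (rule ccontr)
    assume "\<nexists>i. Re (trace X) / CARD('n) \<le> d i"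
    then have "(\<Sum>i\<in>UNIV. d i) < (\<Sum>i\<in>(UNIV::'n set). Re (trace X) / CARD('n))"
      by (intro sum_strict_mono) (auto simp: not_le)
    then show False by (simp add: T)
  qed
  then obtain i where "Re (trace X) / CARD('n) \<le> d i" ..
  then have "(Re (trace X) / CARD('n)) powr s \<le> d i powr s"
    using s by (intro powr_mono2) (auto simp: T d sum_nonneg)
  also have "\<dots> \<le> (\<Sum>i\<in>UNIV. d i powr s)" by (rule member_le_sum) auto
  finally show "(Re (trace X) / CARD('n)) powr s \<le> Re (trace (mat_powr X s))" by (simp add: Ts)
  have "d i powr s \<le> Re (trace X) powr s" for i
    using s by (intro powr_mono2) (auto simp: T d intro: member_le_sum)
  then have "(\<Sum>i\<in>UNIV. d i powr s) \<le> (\<Sum>i\<in>(UNIV::'n set). Re (trace X) powr s)"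
    by (intro sum_mono) auto
  then show "Re (trace (mat_powr X s)) \<le> CARD('n) * Re (trace X) powr s" by (simp add: Ts)
qed

lemma pos_def_invertible:
  assumes "A \<in> pos_def_mats"
  shows "invertible A"
proof -
  have "x = 0" if "A *v x = 0" for x
    using assms that by (metis inner_zero_right less_irrefl pos_def_mats_iff)
  then show ?thesis by (meson invertible_left_inverse matrix_left_invertible_ker)
qed

lemma hermitian_congruence:
  "hermitian_mat M \<Longrightarrow> hermitian_mat (mat_adjoint B ** M ** B)"
  by (simp add: hermitian_mat_def mat_adjoint_mult matrix_mul_assoc)

text \<open>The matrix under the outer power is \<open>mat_adjoint Y ** M ** Y\<close> with
  \<open>Y = mat_powr A r ** K\<close>, hence positive semidefinite. The trace \<open>T\<close>
  makes sense and is continuous in \<open>K\<close> and \<open>M\<close> also at singular matrices,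
  where limits are taken later.\<close>

lemma Lambda_bounds:
  fixes K M A :: "complex^'n^'n"
  assumes A: "A \<in> pos_def_mats" and M: "M \<in> pos_def_mats" and s: "s > 0"
    and T: "T = Re (trace (mat_adjoint K ** mat_powr A r ** M ** mat_powr A r ** K))"
  shows "(T / CARD('n)) powr s \<le> Lambda r s A K M"
    "Lambda r s A K M \<le> CARD('n) * T powr s"
    "0 \<le> T"
proof -
  define Y where "Y = mat_powr A r ** K"
  have "mat_adjoint (mat_powr A r) = mat_powr A r"
    using fun_calculus_hermitian[OF pos_def_hermitian[OF A]]
    by (simp add: mat_powr_def hermitian_mat_def)
  then have X: "mat_adjoint K ** mat_powr A r ** M ** mat_powr A r ** K = mat_adjoint Y ** M ** Y"
    by (simp add: Y_def mat_adjoint_mult matrix_mul_assoc)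
  have H: "hermitian_mat (mat_adjoint Y ** M ** Y)"
    by (intro hermitian_congruence pos_def_hermitian M)
  have psd: "0 \<le> x \<bullet> ((mat_adjoint Y ** M ** Y) *v x)" for x
    using M unfolding inner_congruence pos_def_mats_iff
    by (cases "Y *v x = 0") (auto intro: less_imp_le)
  show "(T / CARD('n)) powr s \<le> Lambda r s A K M"
    "Lambda r s A K M \<le> CARD('n) * T powr s"
    "0 \<le> T"
    unfolding T Lambda_def X by (rule trace_mat_powr_bounds[OF H psd s])+
qed

section \<open>Schatten norms and convexity for exponent 1\<close>

lemma unitary_mat_adjoint: "unitary_mat U \<Longrightarrow> unitary_mat (mat_adjoint U)"
  by (simp add: unitary_mat_def)

lemma unitary_mat_mult:
  assumes "unitary_mat U" "unitary_mat V"
  shows "unitary_mat (U ** V)"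
  by (rule unitary_matI)
    (simp add: mat_adjoint_mult matrix_mul_assoc unitary_cancel[OF assms(1)] unitary_matD[OF assms(2)])

lemma unitary_column_norm:
  assumes "unitary_mat U"
  shows "(\<Sum>i\<in>UNIV. (norm (U $ i $ j))\<^sup>2) = 1"
proof -
  have "(mat_adjoint U ** U) $ j $ j = 1" by (simp add: unitary_matD[OF assms] mat_def)
  then have "(\<Sum>i\<in>UNIV. cnj (U $ i $ j) * U $ i $ j) = 1"
    by (simp add: matrix_matrix_mult_def)
  then have "complex_of_real (\<Sum>i\<in>UNIV. (norm (U $ i $ j))\<^sup>2) = 1"
    by (simp only: of_real_sum complex_norm_square mult.commute)
  then show ?thesis by (metis of_real_eq_1_iff)
qed

lemma unitary_row_norm:
  assumes "unitary_mat U"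
  shows "(\<Sum>j\<in>UNIV. (norm (U $ i $ j))\<^sup>2) = 1"
  using unitary_column_norm[OF unitary_mat_adjoint[OF assms], of i] by simp

text \<open>The singular values are the square roots of the eigenvalues of
  \<open>mat_adjoint X ** X\<close>, positive by invertibility, and rescaling the columns of
  \<open>X ** U\<close> by their inverses gives \<open>V\<close>. The last conclusion is kept
  because the functional calculus is applied to that product.\<close>

lemma svd_invertible:
  fixes X :: "complex^'n^'n"
  assumes "invertible X"
  obtains V \<sigma> U where "unitary_mat V" "unitary_mat U" "\<And>i. 0 < \<sigma> i"
    "X = V ** real_diag \<sigma> ** mat_adjoint U"
    "mat_adjoint X ** X = U ** real_diag (\<lambda>i. (\<sigma> i)\<^sup>2) ** mat_adjoint U"
proof -
  have H: "mat_adjoint X ** X \<in> pos_def_mats"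
  proof -
    have "0 < x \<bullet> ((mat_adjoint X ** X) *v x)" if "x \<noteq> 0" for x
    proof -
      have "X *v x \<noteq> 0"
        using assms that by (metis invertible_left_inverse matrix_left_invertible_ker)
      then show ?thesis using inner_congruence[of x X "mat 1"] by simp
    qed
    then show ?thesis by (simp add: pos_def_mats_iff hermitian_mat_def mat_adjoint_mult)
  qed
  obtain U d where U: "unitary_mat U" and Ud: "mat_adjoint X ** X = U ** real_diag d ** mat_adjoint U"
    using hermitian_diagonalization[OF pos_def_hermitian[OF H]] .
  have d: "0 < d i" for i using pos_def_eigenvalue[OF H U Ud] .
  define V where "V = X ** U ** real_diag (\<lambda>i. 1 / sqrt (d i))"
  have diag: "real_diag f ** real_diag g = real_diag (\<lambda>i. f i * g i)" for f g :: "'n \<Rightarrow> real"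
    by (simp add: vec_eq_iff real_diag_matrix_mult_nth)
  have one: "real_diag (\<lambda>i. 1) = (mat 1 :: complex^'n^'n)" by (simp add: vec_eq_iff mat_def)
  have "mat_adjoint V ** V = real_diag (\<lambda>i. 1 / sqrt (d i)) ** (mat_adjoint U ** (mat_adjoint X ** X) ** U)
      ** real_diag (\<lambda>i. 1 / sqrt (d i))"
    by (simp add: V_def mat_adjoint_mult matrix_mul_assoc)
  also have "mat_adjoint U ** (mat_adjoint X ** X) ** U = real_diag d"
    unfolding Ud by (rule unitary_conjugate[OF U])
  also have "real_diag (\<lambda>i. 1 / sqrt (d i)) ** real_diag d ** real_diag (\<lambda>i. 1 / sqrt (d i)) = mat 1"
    using d by (simp add: diag one less_imp_neq[symmetric] real_div_sqrt less_imp_le field_simps)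
  finally have V: "unitary_mat V" by (rule unitary_matI)
  have "V ** real_diag (\<lambda>i. sqrt (d i)) = X ** U"
    unfolding V_def using d
    by (simp add: matrix_mul_assoc[symmetric] diag one less_imp_neq[symmetric])
  then have "X = V ** real_diag (\<lambda>i. sqrt (d i)) ** mat_adjoint U"
    by (simp add: unitary_cancel[OF U])
  then show thesis
    using that[OF V U, of "\<lambda>i. sqrt (d i)"] d Ud by (simp add: less_imp_le)
qed

text \<open>The entry is a sum of singular values with weights bounded, by AM-GM, by the doubly stochastic
  matrix \<open>(\<bar>V k j\<bar>\<^sup>2 + \<bar>U j k\<bar>\<^sup>2) / 2\<close>; Jensen's inequality then applies row by row.\<close>

lemma sum_diag_powr_le:
  fixes V U :: "complex^'n^'n"
  assumes V: "unitary_mat V" and U: "unitary_mat U" and \<sigma>: "\<And>i. 0 < \<sigma> i" and p: "p \<ge> 1"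
  shows "(\<Sum>k\<in>UNIV. norm ((V ** real_diag \<sigma> ** U) $ k $ k) powr p) \<le> (\<Sum>j\<in>UNIV. \<sigma> j powr p)"
proof -
  define w where "w k j = ((norm (V $ k $ j))\<^sup>2 + (norm (U $ j $ k))\<^sup>2) / 2" for k j
  have w0: "0 \<le> w k j" for k j by (simp add: w_def)
  have row: "(\<Sum>j\<in>UNIV. w k j) = 1" for k
    using unitary_row_norm[OF V, of k] unitary_column_norm[OF U, of k]
    by (simp add: w_def sum_divide_distrib[symmetric] sum.distrib)
  have col: "(\<Sum>k\<in>UNIV. w k j) = 1" for j
    using unitary_column_norm[OF V, of j] unitary_row_norm[OF U, of j]
    by (simp add: w_def sum_divide_distrib[symmetric] sum.distrib)
  have "norm ((V ** real_diag \<sigma> ** U) $ k $ k) powr p \<le> (\<Sum>j\<in>UNIV. w k j * \<sigma> j powr p)" for k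
  proof -
    have "(V ** real_diag \<sigma> ** U) $ k $ k = (\<Sum>j\<in>UNIV. V $ k $ j * of_real (\<sigma> j) * U $ j $ k)"
      by (subst matrix_matrix_mult_def) (simp add: matrix_real_diag_mult_nth)
    also have "norm \<dots> \<le> (\<Sum>j\<in>UNIV. w k j *\<^sub>R \<sigma> j)"
    proof (rule order_trans[OF norm_sum], rule sum_mono)
      fix j
      have "norm (V $ k $ j) * norm (U $ j $ k) \<le> w k j"
        using sum_squares_bound[of "norm (V $ k $ j)" "norm (U $ j $ k)"] by (simp add: w_def)
      then show "norm (V $ k $ j * of_real (\<sigma> j) * U $ j $ k) \<le> w k j *\<^sub>R \<sigma> j"
        using \<sigma>[of j] by (simp add: norm_mult)
    qed
    finally have "norm ((V ** real_diag \<sigma> ** U) $ k $ k) powr p \<le> (\<Sum>j\<in>UNIV. w k j *\<^sub>R \<sigma> j) powr p"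
      using p by (intro powr_mono2) auto
    also have "\<dots> \<le> (\<Sum>j\<in>UNIV. w k j * \<sigma> j powr p)"
      using \<sigma> w0 row by (intro convex_on_sum[OF _ _ powr_convex[OF p]]) auto
    finally show ?thesis .
  qed
  then have "(\<Sum>k\<in>UNIV. norm ((V ** real_diag \<sigma> ** U) $ k $ k) powr p)
      \<le> (\<Sum>k\<in>UNIV. \<Sum>j\<in>UNIV. w k j * \<sigma> j powr p)" by (rule sum_mono)
  also have "\<dots> = (\<Sum>j\<in>UNIV. (\<Sum>k\<in>UNIV. w k j) * \<sigma> j powr p)"
    by (subst sum.swap) (simp add: sum_distrib_right)
  finally show ?thesis by (simp add: col)
qed

text \<open>For \<open>s \<ge> 1/2\<close> this is the Schatten norm of exponent
  \<open>2 * s\<close>, raised to the power \<open>2 * s\<close>.\<close>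

definition schatten :: "real \<Rightarrow> complex^'n^'n \<Rightarrow> real" where
  "schatten s X = Re (trace (mat_powr (mat_adjoint X ** X) s))"

lemma schatten_svd:
  assumes "unitary_mat U" "\<And>i. 0 < \<sigma> i"
    "mat_adjoint X ** X = U ** real_diag (\<lambda>i. (\<sigma> i)\<^sup>2) ** mat_adjoint U"
  shows "schatten s X = (\<Sum>i\<in>UNIV. \<sigma> i powr (2 * s))"
proof -
  have "(\<sigma> i)\<^sup>2 powr s = \<sigma> i powr (2 * s)" for i
    using assms(2)[of i] powr_powr[of "\<sigma> i" 2 s] by simp
  then show ?thesis
    unfolding schatten_def mat_powr_def fun_calculus_eq[OF assms(1,3)] trace_unitary_conjugate[OF assms(1)]
    by simp
qed

text \<open>Inserting the singular value decomposition of \<open>X\<close> leaves its singular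
  values between two unitary matrices, which is the situation of
  \<open>sum_diag_powr_le\<close>.\<close>

lemma sum_diag_powr_le_schatten:
  fixes X :: "complex^'n^'n"
  assumes "invertible X" and V: "unitary_mat V" and U: "unitary_mat U" and s: "s \<ge> 1/2"
  shows "(\<Sum>k\<in>UNIV. norm ((mat_adjoint V ** X ** U) $ k $ k) powr (2 * s)) \<le> schatten s X"
proof -
  obtain Vx \<sigma> Ux where X: "unitary_mat Vx" "unitary_mat Ux" "\<And>i. 0 < \<sigma> i"
    "X = Vx ** real_diag \<sigma> ** mat_adjoint Ux"
    "mat_adjoint X ** X = Ux ** real_diag (\<lambda>i. (\<sigma> i)\<^sup>2) ** mat_adjoint Ux"
    using svd_invertible[OF assms(1)] by blast
  have "mat_adjoint V ** X ** U = (mat_adjoint V ** Vx) ** real_diag \<sigma> ** (mat_adjoint Ux ** U)"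
    unfolding X(4) by (simp add: matrix_mul_assoc)
  then show ?thesis
    unfolding schatten_svd[OF X(2,3,5)]
    using s by (simp only:) (intro sum_diag_powr_le unitary_mat_mult unitary_mat_adjoint V U X; simp add: X)
qed

text \<open>In the singular bases of the convex combination the left-hand side is a sum over diagonal
  entries, and the diagonal entries are linear in the matrix.\<close>

lemma schatten_convex:
  fixes X Y :: "complex^'n^'n"
  assumes XY: "invertible X" "invertible Y" and Z: "invertible (u *\<^sub>R X + v *\<^sub>R Y)"
    and uv: "u \<ge> 0" "v \<ge> 0" "u + v = 1" and s: "s \<ge> 1/2"
  shows "schatten s (u *\<^sub>R X + v *\<^sub>R Y) \<le> u * schatten s X + v * schatten s Y"
proof -
  define Z where "Z = u *\<^sub>R X + v *\<^sub>R Y"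
  obtain V \<sigma> U where Z: "unitary_mat V" "unitary_mat U" "\<And>i. 0 < \<sigma> i"
    "Z = V ** real_diag \<sigma> ** mat_adjoint U"
    "mat_adjoint Z ** Z = U ** real_diag (\<lambda>i. (\<sigma> i)\<^sup>2) ** mat_adjoint U"
    using svd_invertible[OF Z[folded Z_def]] by blast
  let ?x = "\<lambda>k. norm ((mat_adjoint V ** X ** U) $ k $ k)"
  let ?y = "\<lambda>k. norm ((mat_adjoint V ** Y ** U) $ k $ k)"
  \<comment> \<open>Diagonal entries can vanish. If \<open>a\<close> or \<open>b\<close> is 0, the
    claim reduces to \<open>x powr (2 * s) \<le> x\<close> on the unit interval; otherwise it is
    convexity of the power on positive reals.\<close>
  have conv: "(u * a + v * b) powr (2 * s) \<le> u * a powr (2 * s) + v * b powr (2 * s)"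
    if ab: "0 \<le> a" "0 \<le> b" for a b
  proof -
    have le: "x powr (2 * s) \<le> x" if "0 \<le> x" "x \<le> 1" for x :: real
      using powr_mono'[of 1 "2 * s" x] that s by simp
    have u: "u = 1 - v" using uv by simp
    consider "a = 0" | "b = 0" | "0 < a" "0 < b" using ab by linarith
    then show ?thesis
    proof cases
      case 1
      then show ?thesis using le[of v] uv ab by (simp add: powr_mult mult_right_mono)
    next
      case 2
      then show ?thesis using le[of u] uv ab by (simp add: powr_mult mult_right_mono)
    next
      case 3
      then show ?thesis
        using convex_onD[OF powr_convex[of "2 * s"], of v a b] uv s unfolding u by simp
    qed
  qed
  have "\<sigma> k powr (2 * s) \<le> u * ?x k powr (2 * s) + v * ?y k powr (2 * s)" for k
  proof -
    have "mat_adjoint V ** Z ** U = real_diag \<sigma>"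
      by (simp add: Z(4) matrix_mul_assoc unitary_cancel[OF Z(2)] unitary_matD[OF Z(1)])
    then have "of_real (\<sigma> k) = (mat_adjoint V ** Z ** U) $ k $ k" by simp
    also have "\<dots> = u *\<^sub>R (mat_adjoint V ** X ** U) $ k $ k + v *\<^sub>R (mat_adjoint V ** Y ** U) $ k $ k"
      by (simp add: Z_def matrix_mult_linear)
    finally have "norm (complex_of_real (\<sigma> k)) \<le> u * ?x k + v * ?y k"
      using uv by (metis abs_of_nonneg norm_scaleR norm_triangle_ineq)
    then have "\<sigma> k powr (2 * s) \<le> (u * ?x k + v * ?y k) powr (2 * s)"
      using s Z(3)[of k] by (intro powr_mono2) auto
    also have "\<dots> \<le> u * ?x k powr (2 * s) + v * ?y k powr (2 * s)" by (rule conv) auto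
    finally show ?thesis .
  qed
  then have "schatten s Z \<le> (\<Sum>k\<in>UNIV. u * ?x k powr (2 * s) + v * ?y k powr (2 * s))"
    unfolding schatten_svd[OF Z(2,3,5)] by (rule sum_mono)
  also have "\<dots> = u * (\<Sum>k\<in>UNIV. ?x k powr (2 * s)) + v * (\<Sum>k\<in>UNIV. ?y k powr (2 * s))"
    by (simp add: sum.distrib sum_distrib_left)
  also have "\<dots> \<le> u * schatten s X + v * schatten s Y"
    by (intro add_mono mult_left_mono sum_diag_powr_le_schatten XY Z uv s)
  finally show ?thesis by (simp add: Z_def)
qed

section \<open>Sufficiency of \<open>r = 1\<close> and \<open>s \<ge> 1/2\<close>\<close>

lemma pos_def_combination:
  assumes "A \<in> pos_def_mats" "B \<in> pos_def_mats" "u \<ge> 0" "v \<ge> 0" "u + v = 1"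
  shows "u *\<^sub>R A + v *\<^sub>R B \<in> pos_def_mats"
proof -
  have "0 < x \<bullet> ((u *\<^sub>R A + v *\<^sub>R B) *v x)" if "x \<noteq> 0" for x
  proof -
    have "0 < x \<bullet> (A *v x)" "0 < x \<bullet> (B *v x)" using assms that by (auto simp: pos_def_mats_iff)
    then have "0 < u * (x \<bullet> (A *v x)) + v * (x \<bullet> (B *v x))"
      using assms(3-5) by (cases "u = 0") (auto intro: add_pos_nonneg)
    then show ?thesis
      by (simp add: matrix_vector_mult_add_rdistrib scaleR_matrix_vector inner_add_right)
  qed
  then show ?thesis using assms
    by (simp add: pos_def_mats_iff hermitian_mat_def mat_adjoint_linear)
qed

lemma convex_pos_def_mats: "convex pos_def_mats"
  by (auto simp: convex_def intro: pos_def_combination)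

text \<open>Splits \<open>M\<close> between both sides, so that
  \<open>mat_adjoint K ** A ** M ** A ** K\<close> becomes \<open>mat_adjoint X ** X\<close> with
  \<open>X = L ** A ** K\<close>.\<close>

lemma pos_def_factorization:
  fixes M :: "complex^'n^'n"
  assumes "M \<in> pos_def_mats"
  obtains L :: "complex^'n^'n" where "invertible L" "M = mat_adjoint L ** L"
proof -
  obtain U d where U: "unitary_mat U" and M: "M = U ** real_diag d ** mat_adjoint U"
    using hermitian_diagonalization[OF pos_def_hermitian[OF assms]] .
  have d: "0 < d i" for i using pos_def_eigenvalue[OF assms U M] .
  define L :: "complex^'n^'n" where "L = real_diag (\<lambda>i. sqrt (d i)) ** mat_adjoint U"
  have "real_diag (\<lambda>i. sqrt (d i)) ** real_diag (\<lambda>i. sqrt (d i)) = real_diag d"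
    using d by (simp add: vec_eq_iff real_diag_matrix_mult_nth less_imp_le flip: of_real_mult)
  then have M': "M = mat_adjoint L ** L"
    unfolding L_def M mat_adjoint_mult mat_adjoint_real_diag mat_adjoint_adjoint
    by (metis matrix_mul_assoc)
  moreover have "invertible L"
    using pos_def_invertible[OF assms] unfolding M'
    by (metis invertible_def matrix_left_right_inverse matrix_mul_assoc)
  ultimately show thesis using that by blast
qed

text \<open>The matrix \<open>L ** A ** K\<close> is linear in \<open>A\<close> and invertible for
  positive definite \<open>A\<close>, so convexity is pulled back from
  \<open>schatten_convex\<close>.\<close>

lemma Lambda_1_convex:
  fixes K M :: "complex^'n^'n"
  assumes K: "invertible K" and M: "M \<in> pos_def_mats" and s: "s \<ge> 1/2"
  shows "convex_on pos_def_mats (\<lambda>A. Lambda 1 s A K M)"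
proof -
  obtain L :: "complex^'n^'n" where L: "invertible L" "M = mat_adjoint L ** L"
    using pos_def_factorization[OF M] .
  have Lam: "Lambda 1 s A K M = schatten s (L ** A ** K)" if "A \<in> pos_def_mats" for A
    using pos_def_hermitian[OF that]
    by (simp add: Lambda_def schatten_def mat_powr_1 that L mat_adjoint_mult matrix_mul_assoc hermitian_mat_def)
  have inv: "invertible (L ** A ** K)" if "A \<in> pos_def_mats" for A
    by (intro invertible_mult L K pos_def_invertible that)
  show ?thesis
  proof (rule convex_onI)
    fix t :: real and A B :: "complex^'n^'n"
    assume t: "0 < t" "t < 1" and AB: "A \<in> pos_def_mats" "B \<in> pos_def_mats"
    let ?C = "(1 - t) *\<^sub>R A + t *\<^sub>R B"
    have C: "?C \<in> pos_def_mats" using AB t by (intro pos_def_combination) auto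
    have lin: "L ** ?C ** K = (1 - t) *\<^sub>R (L ** A ** K) + t *\<^sub>R (L ** B ** K)"
      by (simp add: matrix_mult_linear)
    show "Lambda 1 s ?C K M \<le> (1 - t) * Lambda 1 s A K M + t * Lambda 1 s B K M"
      unfolding Lam[OF C] Lam[OF AB(1)] Lam[OF AB(2)] lin
      by (rule schatten_convex) (use inv[OF C] inv AB t s in \<open>auto simp: lin\<close>)
  qed (rule convex_pos_def_mats)
qed

section \<open>Rank one limits\<close>

definition outer :: "complex^'n \<Rightarrow> complex^'m \<Rightarrow> complex^'m^'n" where
  "outer a b = (\<chi> i j. a $ i * cnj (b $ j))"

lemma outer_vector: "outer a b *v x = cip b x *s a"
  by (simp add: vec_eq_iff outer_def matrix_vector_mult_def cip_def sum_distrib_left mult_ac)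

lemma matrix_mult_outer: "B ** outer a b = outer (B *v a) b"
  by (simp add: vec_eq_iff outer_def matrix_vector_mult_def matrix_matrix_mult_def
      sum_distrib_left mult_ac)

lemma outer_mult_outer: "outer a b ** outer c d = outer (cip b c *s a) d"
  by (simp add: matrix_mult_outer outer_vector)

lemma trace_outer: "trace (outer a b) = cip b a"
  by (simp add: trace_def outer_def cip_def mult.commute)

lemma mat_adjoint_outer: "mat_adjoint (outer a b) = outer b a"
  by (simp add: vec_eq_iff outer_def)

lemma cip_scale_right: "cip x (c *s y) = c * cip x y"
  by (simp add: cip_def sum_distrib_left mult_ac)

text \<open>Provides admissible approximations of rank one matrices: of \<open>K\<close> and
  \<open>M\<close> with \<open>c = 1\<close>, and of the degenerating \<open>A\<close> in the
  counterexample for \<open>r \<noteq> 1\<close>.\<close>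

lemma scaled_rank_one_perturb_pos_def:
  assumes "c \<ge> 0" "\<delta> > 0"
  shows "c *\<^sub>R outer e e + \<delta> *\<^sub>R mat 1 \<in> pos_def_mats"
proof -
  have "0 < x \<bullet> ((c *\<^sub>R outer e e + \<delta> *\<^sub>R mat 1) *v x)" if "x \<noteq> 0" for x
  proof -
    have "x \<bullet> (outer e e *v x) = Re (cip e x * cip x e)"
      by (simp add: outer_vector cip_scale_right flip: Re_cip)
    also have "\<dots> = (norm (cip e x))\<^sup>2"
      by (simp add: cip_commute[of x e] complex_norm_square[symmetric] flip: of_real_power)
    finally have "x \<bullet> ((c *\<^sub>R outer e e + \<delta> *\<^sub>R mat 1) *v x) = c * (norm (cip e x))\<^sup>2 + \<delta> * (x \<bullet> x)"
      by (simp add: matrix_vector_mult_add_rdistrib scaleR_matrix_vector inner_add_right)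
    then show ?thesis using assms that by (simp add: add_nonneg_pos)
  qed
  then show ?thesis
    by (simp add: pos_def_mats_iff hermitian_mat_def mat_adjoint_linear mat_adjoint_outer)
qed

lemma tendsto_matrix_mult:
  fixes f :: "'a \<Rightarrow> complex^'n^'m" and g :: "'a \<Rightarrow> complex^'k^'n"
  assumes "(f \<longlongrightarrow> A) F" "(g \<longlongrightarrow> B) F"
  shows "((\<lambda>x. f x ** g x) \<longlongrightarrow> A ** B) F"
  unfolding matrix_matrix_mult_def
  by (intro tendsto_vec_lambda tendsto_sum tendsto_mult tendsto_vec_nth assms)

lemma tendsto_trace:
  fixes f :: "'a \<Rightarrow> complex^'n^'n"
  assumes "(f \<longlongrightarrow> A) F"
  shows "((\<lambda>x. trace (f x)) \<longlongrightarrow> trace A) F"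
  unfolding trace_def by (intro tendsto_sum tendsto_vec_nth assms)

lemma tendsto_mat_adjoint:
  fixes f :: "'a \<Rightarrow> complex^'n^'m"
  assumes "(f \<longlongrightarrow> A) F"
  shows "((\<lambda>x. mat_adjoint (f x)) \<longlongrightarrow> mat_adjoint A) F"
  unfolding mat_adjoint_def by (intro tendsto_vec_lambda tendsto_cnj tendsto_vec_nth assms)

abbreviation rank_one_perturb :: "complex^'n \<Rightarrow> real \<Rightarrow> complex^'n^'n" where
  "rank_one_perturb e \<delta> \<equiv> outer e e + \<delta> *\<^sub>R mat 1"

text \<open>The limit of the trace as \<open>K\<close> and \<open>M\<close> tend to
  \<open>outer e e\<close> and \<open>outer f f\<close>, with \<open>B\<close> for the power of
  \<open>A\<close>. It vanishes when \<open>f\<close> is orthogonal to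
  \<open>B *v e\<close>.\<close>

definition rank_one_sandwich :: "complex^'n \<Rightarrow> complex^'n \<Rightarrow> complex^'n^'n \<Rightarrow> real" where
  "rank_one_sandwich e f B = (norm e)\<^sup>2 * (norm (cip f (B *v e)))\<^sup>2"

lemma trace_rank_one_sandwich:
  assumes "hermitian_mat B"
  shows "Re (trace (mat_adjoint (outer e e) ** B ** outer f f ** B ** outer e e))
    = rank_one_sandwich e f B"
proof -
  have "cip e (B *v f) = cnj (cip f (B *v e))"
    using assms by (metis cip_adjoint cip_commute hermitian_mat_def)
  then have "trace (mat_adjoint (outer e e) ** B ** outer f f ** B ** outer e e)
      = complex_of_real (rank_one_sandwich e f B)"
    by (simp add: mat_adjoint_outer matrix_mult_outer outer_vector trace_outer cip_scale_right
        vector_scalar_commute cip_self rank_one_sandwich_def complex_norm_square[symmetric]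
        flip: matrix_mul_assoc matrix_vector_mul_assoc)
  then show ?thesis by simp
qed

definition perturbed_sandwich ::
  "complex^'n \<Rightarrow> complex^'n \<Rightarrow> real \<Rightarrow> complex^'n^'n \<Rightarrow> real" where
  "perturbed_sandwich e f \<delta> B = Re (trace (mat_adjoint (rank_one_perturb e \<delta>) ** B
     ** rank_one_perturb f \<delta> ** B ** rank_one_perturb e \<delta>))"

text \<open>\<open>A\<close> may vary with \<open>\<delta>\<close>, since one counterexample lets it
  degenerate together with \<open>K\<close> and \<open>M\<close>.\<close>

lemma perturbed_sandwich_tendsto:
  assumes A: "\<And>\<delta>. \<delta> > 0 \<Longrightarrow> A \<delta> \<in> pos_def_mats" and lim: "((\<lambda>\<delta>. mat_powr (A \<delta>) r) \<longlongrightarrow> B) (at_right 0)"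
  shows "((\<lambda>\<delta>. perturbed_sandwich e f \<delta> (mat_powr (A \<delta>) r)) \<longlongrightarrow> rank_one_sandwich e f B) (at_right 0)"
proof -
  \<comment> \<open>As a limit of Hermitian matrices \<open>B\<close> is Hermitian, which
    \<open>trace_rank_one_sandwich\<close> requires.\<close>
  have "((\<lambda>\<delta>. mat_adjoint (mat_powr (A \<delta>) r)) \<longlongrightarrow> mat_adjoint B) (at_right 0)"
    by (rule tendsto_mat_adjoint[OF lim])
  moreover have "eventually (\<lambda>\<delta>. mat_adjoint (mat_powr (A \<delta>) r) = mat_powr (A \<delta>) r) (at_right 0)"
    using fun_calculus_hermitian[OF pos_def_hermitian[OF A]]
    by (auto simp: eventually_at_filter hermitian_mat_def mat_powr_def)
  ultimately have "((\<lambda>\<delta>. mat_powr (A \<delta>) r) \<longlongrightarrow> mat_adjoint B) (at_right 0)"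
    using tendsto_cong by force
  then have herm: "hermitian_mat B"
    using lim by (auto simp: hermitian_mat_def intro: tendsto_unique[rotated])
  have perturb: "((\<lambda>\<delta>. rank_one_perturb e \<delta>) \<longlongrightarrow> outer e e) (at_right 0)" for e :: "complex^'a"
  proof -
    have "((\<lambda>\<delta>. rank_one_perturb e \<delta>) \<longlongrightarrow> rank_one_perturb e 0) (at_right 0)"
      by (intro tendsto_intros)
    then show ?thesis by simp
  qed
  show ?thesis
    unfolding trace_rank_one_sandwich[OF herm, symmetric] unfolding perturbed_sandwich_def
    by (intro tendsto_Re tendsto_trace tendsto_matrix_mult tendsto_mat_adjoint perturb lim)
qed

lemma rank_one_perturb_pos_def: "\<delta> > 0 \<Longrightarrow> rank_one_perturb e \<delta> \<in> pos_def_mats"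
  using scaled_rank_one_perturb_pos_def[of 1 \<delta> e] by simp

lemma Lambda_perturbed_bounds:
  fixes A :: "complex^'n^'n"
  assumes "\<delta> > 0" "A \<in> pos_def_mats" "s > 0"
  fixes e f :: "complex^'n" and r :: real
  defines "T \<equiv> perturbed_sandwich e f \<delta> (mat_powr A r)"
  shows "(T / CARD('n)) powr s \<le> Lambda r s A (rank_one_perturb e \<delta>) (rank_one_perturb f \<delta>)"
    "Lambda r s A (rank_one_perturb e \<delta>) (rank_one_perturb f \<delta>) \<le> CARD('n) * T powr s"
    "0 \<le> T"
  unfolding T_def perturbed_sandwich_def
  by (intro Lambda_bounds[OF assms(2) rank_one_perturb_pos_def[OF assms(1)] assms(3) refl])+

lemma perturbed_sandwich_nonneg:
  assumes "\<And>\<delta>. \<delta> > 0 \<Longrightarrow> A \<delta> \<in> pos_def_mats"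
  shows "eventually (\<lambda>\<delta>. 0 \<le> perturbed_sandwich e f \<delta> (mat_powr (A \<delta>) r)) (at_right 0)"
  using Lambda_perturbed_bounds(3)[OF _ assms zero_less_one] by (auto simp: eventually_at_filter)

text \<open>Testing convexity against \<open>K \<rightarrow> e e\<^sup>*\<close> and \<open>M \<rightarrow> f f\<^sup>*\<close>: up to dimensional constants
  \<open>\<Lambda>\<close> tends to a power of \<open>\<bar>\<langle>f, A\<^sup>r e\<rangle>\<bar>\<close>.\<close>

lemma Lambda_convex_limit:
  fixes A\<^sub>1 A\<^sub>2 :: "real \<Rightarrow> complex^'n^'n"
  assumes conv: "\<And>K M :: complex^'n^'n. invertible K \<Longrightarrow> M \<in> pos_def_mats \<Longrightarrow>
      convex_on pos_def_mats (\<lambda>A. Lambda r s A K M)"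
    and s: "s > 0" and uv: "u \<ge> 0" "v \<ge> 0" "u + v = 1"
    and A: "\<And>\<delta>. \<delta> > 0 \<Longrightarrow> A\<^sub>1 \<delta> \<in> pos_def_mats" "\<And>\<delta>. \<delta> > 0 \<Longrightarrow> A\<^sub>2 \<delta> \<in> pos_def_mats"
    and lim: "((\<lambda>\<delta>. mat_powr (A\<^sub>1 \<delta>) r) \<longlongrightarrow> B\<^sub>1) (at_right 0)"
      "((\<lambda>\<delta>. mat_powr (A\<^sub>2 \<delta>) r) \<longlongrightarrow> B\<^sub>2) (at_right 0)"
      "((\<lambda>\<delta>. mat_powr (u *\<^sub>R A\<^sub>1 \<delta> + v *\<^sub>R A\<^sub>2 \<delta>) r) \<longlongrightarrow> B) (at_right 0)"
  shows "(rank_one_sandwich e f B / CARD('n)) powr s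
    \<le> u * (CARD('n) * rank_one_sandwich e f B\<^sub>1 powr s)
      + v * (CARD('n) * rank_one_sandwich e f B\<^sub>2 powr s)"
proof -
  define C where "C \<delta> = u *\<^sub>R A\<^sub>1 \<delta> + v *\<^sub>R A\<^sub>2 \<delta>" for \<delta>
  define T where "T \<delta> A = perturbed_sandwich e f \<delta> (mat_powr A r)" for \<delta> A
  define L where "L \<delta> A = Lambda r s A (rank_one_perturb e \<delta>) (rank_one_perturb f \<delta>)" for \<delta> A
  have C: "C \<delta> \<in> pos_def_mats" if "\<delta> > 0" for \<delta>
    unfolding C_def using A that uv by (intro pos_def_combination)
  note bounds = Lambda_perturbed_bounds[OF _ _ s, where e=e and f=f and r=r, folded T_def L_def]
  have ev: "eventually (\<lambda>\<delta>. (T \<delta> (C \<delta>) / CARD('n)) powr s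
      \<le> u * (CARD('n) * T \<delta> (A\<^sub>1 \<delta>) powr s) + v * (CARD('n) * T \<delta> (A\<^sub>2 \<delta>) powr s)) (at_right 0)"
    unfolding eventually_at_filter
  proof (rule always_eventually, intro allI impI)
    fix \<delta> :: real assume "\<delta> \<noteq> 0" "\<delta> \<in> {0<..}"
    then have \<delta>: "\<delta> > 0" by simp
    have "(T \<delta> (C \<delta>) / CARD('n)) powr s \<le> L \<delta> (C \<delta>)"
      by (rule bounds(1)[OF \<delta> C[OF \<delta>]])
    also have "\<dots> \<le> u * L \<delta> (A\<^sub>1 \<delta>) + v * L \<delta> (A\<^sub>2 \<delta>)"
      using conv[OF pos_def_invertible rank_one_perturb_pos_def, OF rank_one_perturb_pos_def, OF \<delta> \<delta>] A \<delta> uv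
      unfolding convex_on_def L_def C_def by blast
    also have "\<dots> \<le> u * (CARD('n) * T \<delta> (A\<^sub>1 \<delta>) powr s) + v * (CARD('n) * T \<delta> (A\<^sub>2 \<delta>) powr s)"
      using bounds(2) \<delta> A uv by (intro add_mono mult_left_mono) auto
    finally show "(T \<delta> (C \<delta>) / CARD('n)) powr s
      \<le> u * (CARD('n) * T \<delta> (A\<^sub>1 \<delta>) powr s) + v * (CARD('n) * T \<delta> (A\<^sub>2 \<delta>) powr s)" .
  qed
  have lims: "((\<lambda>\<delta>. T \<delta> (A\<^sub>1 \<delta>)) \<longlongrightarrow> rank_one_sandwich e f B\<^sub>1) (at_right 0)"
      "((\<lambda>\<delta>. T \<delta> (A\<^sub>2 \<delta>)) \<longlongrightarrow> rank_one_sandwich e f B\<^sub>2) (at_right 0)"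
      "((\<lambda>\<delta>. T \<delta> (C \<delta>)) \<longlongrightarrow> rank_one_sandwich e f B) (at_right 0)"
    unfolding T_def using A C lim by (auto intro!: perturbed_sandwich_tendsto simp: C_def)
  \<comment> \<open>The limits may be 0, where convergence of \<open>powr\<close> is obtained from a
    positive exponent and eventually nonnegative bases.\<close>
  have nonneg: "eventually (\<lambda>\<delta>. 0 \<le> T \<delta> (A\<^sub>1 \<delta>)) (at_right 0)"
      "eventually (\<lambda>\<delta>. 0 \<le> T \<delta> (A\<^sub>2 \<delta>)) (at_right 0)"
      "eventually (\<lambda>\<delta>. 0 \<le> T \<delta> (C \<delta>)) (at_right 0)"
    unfolding T_def using A C by (auto intro!: perturbed_sandwich_nonneg)
  have "eventually (\<lambda>\<delta>. 0 \<le> T \<delta> (C \<delta>) / CARD('n)) (at_right 0)"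
    using nonneg(3) by (rule eventually_mono) auto
  then show ?thesis
    by (intro tendsto_le[OF _ _ _ ev]) (use s nonneg in \<open>auto intro!: tendsto_intros lims\<close>)
qed

text \<open>The \<open>A\<^sub>2\<close> term is bounded below by 0, so only the
  \<open>A\<^sub>1\<close> term remains on the left; a zero of the limit at the combination then
  forces a zero at \<open>A\<^sub>1\<close> when \<open>u > 0\<close>.\<close>

lemma Lambda_concave_limit:
  fixes A\<^sub>1 A\<^sub>2 :: "complex^'n^'n"
  assumes conc: "\<And>K M :: complex^'n^'n. invertible K \<Longrightarrow> M \<in> pos_def_mats \<Longrightarrow>
      concave_on pos_def_mats (\<lambda>A. Lambda r s A K M)"
    and s: "s > 0" and uv: "u \<ge> 0" "v \<ge> 0" "u + v = 1"
    and A: "A\<^sub>1 \<in> pos_def_mats" "A\<^sub>2 \<in> pos_def_mats"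
  shows "u * (rank_one_sandwich e f (mat_powr A\<^sub>1 r) / CARD('n)) powr s
    \<le> CARD('n) * rank_one_sandwich e f (mat_powr (u *\<^sub>R A\<^sub>1 + v *\<^sub>R A\<^sub>2) r) powr s"
proof -
  define C where "C = u *\<^sub>R A\<^sub>1 + v *\<^sub>R A\<^sub>2"
  define T where "T \<delta> A = perturbed_sandwich e f \<delta> (mat_powr A r)" for \<delta> A
  define L where "L \<delta> A = Lambda r s A (rank_one_perturb e \<delta>) (rank_one_perturb f \<delta>)" for \<delta> A
  have C: "C \<in> pos_def_mats"
    unfolding C_def using A uv by (intro pos_def_combination)
  note bounds = Lambda_perturbed_bounds[OF _ _ s, where e=e and f=f and r=r, folded T_def L_def]
  have ev: "eventually (\<lambda>\<delta>. u * (T \<delta> A\<^sub>1 / CARD('n)) powr s \<le> CARD('n) * T \<delta> C powr s) (at_right 0)"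
    unfolding eventually_at_filter
  proof (rule always_eventually, intro allI impI)
    fix \<delta> :: real assume "\<delta> \<noteq> 0" "\<delta> \<in> {0<..}"
    then have \<delta>: "\<delta> > 0" by simp
    have "0 \<le> (T \<delta> A\<^sub>2 / CARD('n)) powr s" by simp
    also have "\<dots> \<le> L \<delta> A\<^sub>2" by (rule bounds(1)[OF \<delta> A(2)])
    finally have "u * (T \<delta> A\<^sub>1 / CARD('n)) powr s \<le> u * L \<delta> A\<^sub>1 + v * L \<delta> A\<^sub>2"
      using bounds(1)[OF \<delta> A(1)] uv by (simp add: mult_left_mono add_increasing2)
    also have "\<dots> \<le> L \<delta> C"
      using conc[OF pos_def_invertible rank_one_perturb_pos_def, OF rank_one_perturb_pos_def, OF \<delta> \<delta>] A uv
      unfolding concave_on_iff L_def C_def by blast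
    also have "\<dots> \<le> CARD('n) * T \<delta> C powr s"
      by (rule bounds(2)[OF \<delta> C])
    finally show "u * (T \<delta> A\<^sub>1 / CARD('n)) powr s \<le> CARD('n) * T \<delta> C powr s" .
  qed
  have lims: "((\<lambda>\<delta>. T \<delta> A) \<longlongrightarrow> rank_one_sandwich e f (mat_powr A r)) (at_right 0)"
    if "A \<in> pos_def_mats" for A
    unfolding T_def by (rule perturbed_sandwich_tendsto) (use that in auto)
  have nonneg: "eventually (\<lambda>\<delta>. 0 \<le> T \<delta> A) (at_right 0)" if "A \<in> pos_def_mats" for A
    unfolding T_def by (rule perturbed_sandwich_nonneg) (rule that)
  have "eventually (\<lambda>\<delta>. 0 \<le> T \<delta> A\<^sub>1 / CARD('n)) (at_right 0)"
    using nonneg[OF A(1)] by (rule eventually_mono) auto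
  then show ?thesis unfolding C_def[symmetric]
    by (intro tendsto_le[OF _ _ _ ev])
      (use s nonneg[OF C] in \<open>auto intro!: tendsto_intros lims A C\<close>)
qed

section \<open>Counterexamples\<close>

text \<open>The test vectors live in the plane of two coordinates, so a two dimensional
  counterexample serves for every \<open>n \<ge> 2\<close>.\<close>

definition plane_vec :: "'n \<Rightarrow> 'n \<Rightarrow> real \<Rightarrow> real \<Rightarrow> complex^'n" where
  "plane_vec i j a b = (\<chi> k. if k = i then of_real a else if k = j then of_real b else 0)"

lemma sum_two_points:
  fixes h :: "'n::finite \<Rightarrow> complex"
  assumes "i \<noteq> j" "\<And>k. k \<noteq> i \<Longrightarrow> k \<noteq> j \<Longrightarrow> h k = 0"
  shows "(\<Sum>k\<in>UNIV. h k) = h i + h j"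
proof -
  have "(\<Sum>k\<in>UNIV. h k) = (\<Sum>k\<in>{i, j}. h k)"
    by (rule sum.mono_neutral_right) (use assms in auto)
  then show ?thesis using assms(1) by simp
qed

lemma cip_plane_vec:
  assumes "i \<noteq> j"
  shows "cip (plane_vec i j a b) (plane_vec i j c d) = of_real (a * c + b * d)"
  using assms unfolding cip_def
  by (subst sum_two_points[OF assms]) (auto simp: plane_vec_def)

lemma real_diag_vector_nth: "(real_diag d *v x) $ k = of_real (d k) * x $ k"
  by (simp add: matrix_vector_mult_def if_distrib[of "\<lambda>x. x * _"] cong: if_cong)

lemma real_diag_plane_vec:
  "real_diag d *v plane_vec i j a b = plane_vec i j (d i * a) (d j * b)"
  by (simp add: vec_eq_iff real_diag_vector_nth plane_vec_def)

lemma norm_plane_vec: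
  assumes "i \<noteq> j"
  shows "(norm (plane_vec i j a b))\<^sup>2 = a * a + b * b"
  using cip_self[of "plane_vec i j a b"] unfolding cip_plane_vec[OF assms]
  by (simp only: of_real_eq_iff)

text \<open>The factor 2 is the squared norm of the vector with entries 1 and 1.\<close>

lemma rank_one_sandwich_diag:
  assumes "i \<noteq> j"
  shows "rank_one_sandwich (plane_vec i j 1 1) (plane_vec i j a b) (real_diag d)
    = 2 * (a * d i + b * d j)\<^sup>2"
  unfolding rank_one_sandwich_def norm_plane_vec[OF assms] real_diag_plane_vec cip_plane_vec[OF assms] norm_of_real
  by simp

lemma real_diag_pos_def:
  assumes "\<And>k. d k > 0"
  shows "real_diag d \<in> pos_def_mats"
proof -
  have "0 < x \<bullet> (real_diag d *v x)" if "x \<noteq> 0" for x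
  proof -
    have "x \<bullet> (real_diag d *v x) = (\<Sum>k\<in>UNIV. d k * (x $ k \<bullet> x $ k))"
      by (simp add: inner_vec_def real_diag_vector_nth flip: scaleR_conv_of_real)
    moreover have "\<exists>k. x $ k \<noteq> 0" using that by (simp add: vec_eq_iff)
    then obtain k where "x $ k \<noteq> 0" ..
    then have "0 < (\<Sum>k\<in>UNIV. d k * (x $ k \<bullet> x $ k))"
      using assms by (intro sum_pos2[of _ k]) (auto simp: less_imp_le)
    ultimately show ?thesis by simp
  qed
  then show ?thesis by (simp add: pos_def_mats_iff hermitian_mat_def)
qed

lemma real_diag_combination:
  "u *\<^sub>R real_diag d + v *\<^sub>R real_diag d' = real_diag (\<lambda>k. u * d k + v * d' k)"
  unfolding vec_eq_iff vector_add_component vector_scaleR_component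
  by (simp add: scaleR_conv_of_real)

lemma mat_powr_real_diag: "mat_powr (real_diag d) r = real_diag (\<lambda>k. d k powr r)"
  unfolding mat_powr_def by (rule fun_calculus_real_diag)

text \<open>At \<open>A = 1\<close> the limiting functional \<open>\<bar>\<langle>f, A\<^sup>r e\<rangle>\<bar>\<close> vanishes for \<open>f \<bottom> e\<close>, whereas a nonnegative
  concave function that vanishes at an interior point is zero.\<close>

lemma Lambda_not_concave:
  assumes n: "CARD('n::finite) \<ge> 2" and r: "r \<noteq> 0" and s: "s > 0"
  shows "\<not> (\<forall>K M :: complex^'n^'n. invertible K \<longrightarrow> M \<in> pos_def_mats \<longrightarrow>
    concave_on pos_def_mats (\<lambda>A. Lambda r s A K M))"
proof
  assume conc: "\<forall>K M :: complex^'n^'n. invertible K \<longrightarrow> M \<in> pos_def_mats \<longrightarrow>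
    concave_on pos_def_mats (\<lambda>A. Lambda r s A K M)"
  obtain i j :: 'n where ij: "i \<noteq> j" using n by (metis card_2_iff' ex_card)
  define d where "d t k = (if k = i then t else 1)" for t :: real and k :: 'n
  have pd: "real_diag (d t) \<in> pos_def_mats" if "t > 0" for t
    by (rule real_diag_pos_def) (use that in \<open>simp add: d_def\<close>)
  \<comment> \<open>The identity fixes the vector \<open>e\<close> chosen below, which is orthogonal
    to \<open>f\<close>, so the limiting value at this midpoint is 0.\<close>
  have mid: "(1/2) *\<^sub>R real_diag (d (3/2)) + (1/2) *\<^sub>R real_diag (d (1/2)) = real_diag (\<lambda>_. 1)"
    unfolding real_diag_combination by (rule arg_cong[of _ _ real_diag]) (auto simp: d_def)
  have "(1/2) * (2 * ((3/2) powr r - 1)\<^sup>2 / CARD('n)) powr s \<le> 0"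
    using Lambda_concave_limit[where A\<^sub>1="real_diag (d (3/2))" and A\<^sub>2="real_diag (d (1/2))" and r=r
        and s=s and u="1/2" and v="1/2" and e="plane_vec i j 1 1" and f="plane_vec i j 1 (-1)"] conc pd s ij
    unfolding mid by (simp add: mat_powr_real_diag rank_one_sandwich_diag[OF ij] d_def)
  moreover have "(3/2::real) powr r \<noteq> 1" using r powr_eq_one_iff_gen[of "3/2" r] by simp
  then have "0 < (2 * ((3/2) powr r - 1)\<^sup>2 / CARD('n)) powr s"
    unfolding powr_gt_zero by simp
  ultimately show False by linarith
qed

text \<open>Along the diagonal matrices with entries \<open>t\<close> and \<open>1\<close> the limiting functional is a power of
  \<open>\<bar>t\<^sup>r - 1\<bar>\<close>, which vanishes at \<open>t = 1\<close> and is bounded for \<open>t \<ge> 1\<close> but not constant.\<close>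

lemma convex_imp_nonneg_exponent:
  assumes n: "CARD('n::finite) \<ge> 2" and s: "s > 0"
    and conv: "\<And>K M :: complex^'n^'n. invertible K \<Longrightarrow> M \<in> pos_def_mats \<Longrightarrow>
      convex_on pos_def_mats (\<lambda>A. Lambda r s A K M)"
  shows "r \<ge> 0"
proof (rule ccontr)
  assume "\<not> r \<ge> 0"
  then have r: "r < 0" by simp
  obtain i j :: 'n where ij: "i \<noteq> j" using n by (metis card_2_iff' ex_card)
  define d where "d t k = (if k = i then t else 1)" for t :: real and k :: 'n
  have pd: "real_diag (d t) \<in> pos_def_mats" if "t > 0" for t
    by (rule real_diag_pos_def) (use that in \<open>simp add: d_def\<close>)
  define c where "c = (2 * (2 powr r - 1)\<^sup>2 / CARD('n)) powr s"
  define b where "b = CARD('n) * 2 powr s"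
  have "(2::real) powr r \<noteq> 1" using r powr_eq_one_iff_gen[of 2 r] by simp
  then have c: "0 < c" by (simp add: c_def)
  have le: "c \<le> v * b" if v: "0 < v" "v \<le> 1" for v
  proof -
    \<comment> \<open>The far point \<open>1 + 1 / v\<close> keeps the combination at
      \<open>t = 2\<close> for every weight \<open>v\<close>. The left side \<open>c\<close> stays
      fixed while the bound \<open>v * b\<close> tends to 0.\<close>
    have mid: "(1 - v) *\<^sub>R real_diag (d 1) + v *\<^sub>R real_diag (d (1 + 1 / v)) = real_diag (d 2)"
      unfolding real_diag_combination using v
      by (intro arg_cong[of _ _ real_diag]) (auto simp: d_def field_simps)
    have "(rank_one_sandwich (plane_vec i j 1 1) (plane_vec i j 1 (-1)) (mat_powr (real_diag (d 2)) r) / CARD('n)) powr s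
      \<le> (1 - v) * (CARD('n) * rank_one_sandwich (plane_vec i j 1 1) (plane_vec i j 1 (-1))
            (mat_powr (real_diag (d 1)) r) powr s)
        + v * (CARD('n) * rank_one_sandwich (plane_vec i j 1 1) (plane_vec i j 1 (-1))
            (mat_powr (real_diag (d (1 + 1 / v))) r) powr s)"
      by (rule Lambda_convex_limit[OF conv s, where A\<^sub>1="\<lambda>_. real_diag (d 1)" and A\<^sub>2="\<lambda>_. real_diag (d (1 + 1 / v))"])
        (use pd v in \<open>auto simp: mid add_pos_pos\<close>)
    then have "c \<le> v * (CARD('n) * (2 * ((1 + 1 / v) powr r - 1)\<^sup>2) powr s)"
      using ij by (simp add: mat_powr_real_diag rank_one_sandwich_diag[OF ij] d_def c_def)
    also have "\<dots> \<le> v * b"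
    proof -
      have "0 < 1 / v" using v by simp
      then have "(1 + 1 / v) powr r \<le> 1" using powr_mono[of r 0 "1 + 1 / v"] r
        by (auto split: if_splits)
      moreover have "0 \<le> (1 + 1 / v) powr r" by simp
      ultimately have "((1 + 1 / v) powr r - 1)\<^sup>2 \<le> 1"
        by (simp add: abs_square_le_1 abs_le_iff)
      then show ?thesis unfolding b_def using v s
        by (intro mult_left_mono powr_mono2) auto
    qed
    finally show ?thesis .
  qed
  have b: "b > 0" by (simp add: b_def)
  \<comment> \<open>Makes \<open>v * b\<close> at most half of \<open>c\<close> while
    \<open>v\<close> remains a weight.\<close>
  define v where "v = min 1 (c / (2 * b))"
  have "v * b \<le> c / (2 * b) * b" unfolding v_def using b by (intro mult_right_mono) auto
  also have "\<dots> < c" using b c by simp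
  finally show False using le[of v] b c by (simp add: v_def)
qed

text \<open>The eigenvalues are \<open>c + \<delta>\<close> on the range of \<open>P\<close> and
  \<open>\<delta>\<close> on its kernel; the latter contribute nothing in the limit because
  \<open>r > 0\<close>.\<close>

lemma projection_powr_tendsto:
  fixes P :: "complex^'n^'n"
  assumes P: "hermitian_mat P" "P ** P = P" and "c > 0" "r > 0"
  shows "((\<lambda>\<delta>. mat_powr (c *\<^sub>R P + \<delta> *\<^sub>R mat 1) r) \<longlongrightarrow> c powr r *\<^sub>R P) (at_right 0)"
proof -
  have "mat_powr (c *\<^sub>R P + \<delta> *\<^sub>R mat 1) r
      = (c + \<delta>) powr r *\<^sub>R P + \<delta> powr r *\<^sub>R (mat 1 - P)" for \<delta>
  proof -
    have "c *\<^sub>R P + \<delta> *\<^sub>R mat 1 = (c + \<delta>) *\<^sub>R P + \<delta> *\<^sub>R (mat 1 - P)"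
      by (simp add: algebra_simps)
    then show ?thesis
      unfolding mat_powr_def by (simp add: fun_calculus_projection[OF P])
  qed
  moreover have "((\<lambda>\<delta>. (c + \<delta>) powr r *\<^sub>R P + \<delta> powr r *\<^sub>R (mat 1 - P))
      \<longlongrightarrow> (c + 0) powr r *\<^sub>R P + 0 powr r *\<^sub>R (mat 1 - P)) (at_right 0)"
    using assms
    by (intro tendsto_add tendsto_scaleR tendsto_const tendsto_powr' tendsto_ident_at)
      (auto simp: eventually_at_filter)
  ultimately show ?thesis by simp
qed

lemma outer_projection:
  assumes "norm g \<noteq> 0"
  defines "P \<equiv> (1 / (norm g)\<^sup>2) *\<^sub>R outer g g"
  shows "hermitian_mat P" "P ** P = P"
proof -
  show "hermitian_mat P"
    by (simp add: P_def hermitian_mat_def mat_adjoint_linear mat_adjoint_outer)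
  have "outer g g ** outer g g = (norm g)\<^sup>2 *\<^sub>R outer g g"
    unfolding outer_mult_outer
    by (simp add: cip_self vec_eq_iff outer_def scaleR_conv_of_real[where 'a=complex] mult.assoc)
  then show "P ** P = P"
    using assms(1) by (simp add: P_def matrix_mult_linear)
qed

text \<open>For \<open>e = (1, 1)\<close>, \<open>g = (1, 2)\<close>, \<open>k = (1, -1)\<close> the matrix \<open>diag(1, 2) = g g\<^sup>* / 3 + 2 k k\<^sup>* / 3\<close> maps
  \<open>e\<close> to \<open>g\<close>, and \<open>k \<bottom> e\<close>. With \<open>f = (2, -1) \<bottom> g\<close>, the limiting functional vanishes at the two
  rank one summands for every power \<open>r > 0\<close>; at their midpoint it is \<open>\<bar>2 - 2\<^sup>r\<bar>\<close>.\<close>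

lemma convex_imp_exponent_1:
  assumes n: "CARD('n::finite) \<ge> 2" and s: "s > 0" and r: "r > 0"
    and conv: "\<And>K M :: complex^'n^'n. invertible K \<Longrightarrow> M \<in> pos_def_mats \<Longrightarrow>
      convex_on pos_def_mats (\<lambda>A. Lambda r s A K M)"
  shows "r = 1"
proof (rule ccontr)
  assume r1: "r \<noteq> 1"
  obtain i j :: 'n where ij: "i \<noteq> j" using n by (metis card_2_iff' ex_card)
  define d where "d k = (if k = i then 1 else if k = j then 2 else 0 :: real)" for k
  let ?e = "plane_vec i j 1 1" and ?f = "plane_vec i j 2 (-1)"
  let ?g = "plane_vec i j 1 2" and ?k = "plane_vec i j 1 (-1)"
  define A\<^sub>1 where "A\<^sub>1 \<delta> = (2/3) *\<^sub>R outer ?g ?g + \<delta> *\<^sub>R mat 1" for \<delta>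
  define A\<^sub>2 where "A\<^sub>2 \<delta> = (4/3) *\<^sub>R outer ?k ?k + \<delta> *\<^sub>R mat 1" for \<delta>
  have pd: "A\<^sub>1 \<delta> \<in> pos_def_mats" "A\<^sub>2 \<delta> \<in> pos_def_mats" if "\<delta> > 0" for \<delta>
    using that by (auto simp: A\<^sub>1_def A\<^sub>2_def intro: scaled_rank_one_perturb_pos_def)
  have ng: "norm ?g \<noteq> 0" "norm ?k \<noteq> 0"
    using norm_plane_vec[OF ij, of 1 2] norm_plane_vec[OF ij, of 1 "-1"] by auto
  define P where "P = (1/5) *\<^sub>R outer ?g ?g"
  define Q where "Q = (1/2) *\<^sub>R outer ?k ?k"
  have P: "hermitian_mat P" "P ** P = P" and Q: "hermitian_mat Q" "Q ** Q = Q"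
    using outer_projection[OF ng(1)] outer_projection[OF ng(2)]
    by (simp_all add: norm_plane_vec[OF ij] P_def Q_def)
  \<comment> \<open>The scale is \<open>10/3 = (2/3) * 5\<close>, where 5 is the squared norm of
    \<open>?g\<close>; likewise \<open>8/3 = (4/3) * 2\<close> for \<open>?k\<close>.\<close>
  have lim1: "((\<lambda>\<delta>. mat_powr (A\<^sub>1 \<delta>) r) \<longlongrightarrow> (10/3) powr r *\<^sub>R P) (at_right 0)"
    using projection_powr_tendsto[OF P _ r, of "10/3"] by (simp add: A\<^sub>1_def P_def)
  have lim2: "((\<lambda>\<delta>. mat_powr (A\<^sub>2 \<delta>) r) \<longlongrightarrow> (8/3) powr r *\<^sub>R Q) (at_right 0)"
    using projection_powr_tendsto[OF Q _ r, of "8/3"] by (simp add: A\<^sub>2_def Q_def)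
  \<comment> \<open>The coefficients 2/3 and 4/3 are doubled because the midpoint halves them.
    Outside the plane only the common shift \<open>\<delta>\<close> is left, which is why
    \<open>d\<close> is 0 there.\<close>
  have mid: "(1/2) *\<^sub>R A\<^sub>1 \<delta> + (1/2) *\<^sub>R A\<^sub>2 \<delta> = real_diag (\<lambda>k. d k + \<delta>)" for \<delta>
    using ij by (simp add: vec_eq_iff A\<^sub>1_def A\<^sub>2_def d_def outer_def plane_vec_def mat_def
        scaleR_conv_of_real[where 'a=complex] add_divide_distrib)
  have "((\<lambda>\<delta>. real_diag (\<lambda>k. (d k + \<delta>) powr r)) \<longlongrightarrow> real_diag (\<lambda>k. (d k + 0) powr r)) (at_right 0)"
  proof -
    have "((\<lambda>\<delta>. (d k + \<delta>) powr r) \<longlongrightarrow> (d k + 0) powr r) (at_right 0)" for k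
      using r by (intro tendsto_powr' tendsto_intros) (auto simp: d_def eventually_at_filter)
    then show ?thesis unfolding real_diag_def
      by (intro tendsto_vec_lambda) (auto intro!: tendsto_of_real)
  qed
  then have lim3: "((\<lambda>\<delta>. mat_powr ((1/2) *\<^sub>R A\<^sub>1 \<delta> + (1/2) *\<^sub>R A\<^sub>2 \<delta>) r)
      \<longlongrightarrow> real_diag (\<lambda>k. d k powr r)) (at_right 0)"
    by (simp add: mid mat_powr_real_diag)
  have PQ: "rank_one_sandwich ?e ?f (c *\<^sub>R P) = 0" "rank_one_sandwich ?e ?f (c *\<^sub>R Q) = 0" for c
    by (simp_all add: rank_one_sandwich_def P_def Q_def scaleR_matrix_vector outer_vector
        cip_scaleR_right cip_scale_right cip_plane_vec[OF ij])
  have "rank_one_sandwich ?e ?f (real_diag (\<lambda>k. d k powr r)) = 2 * (2 - 2 powr r)\<^sup>2"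
    using ij by (simp add: rank_one_sandwich_diag[OF ij] d_def)
  then have "(2 * (2 - 2 powr r)\<^sup>2 / CARD('n)) powr s \<le> 0"
    using Lambda_convex_limit[OF conv s _ _ _ pd lim1 lim2 lim3, where e="?e" and f="?f"]
    unfolding PQ by simp
  moreover have "(2::real) powr r \<noteq> 2" using r1 powr_inj[of 2 r 1] by simp
  then have "0 < (2 * (2 - 2 powr r)\<^sup>2 / CARD('n)) powr s" by simp
  ultimately show False by linarith
qed

section \<open>Scalar matrices and the bound on the outer exponent\<close>

lemma Lambda_scalar:
  assumes "t > 0"
  shows "Lambda 1 s (real_diag (\<lambda>_. t)) (mat 1) (mat 1 :: complex^'n^'n) = CARD('n) * t powr (2 * s)"
proof -
  have "real_diag (\<lambda>_. t) ** real_diag (\<lambda>_. t) = (real_diag (\<lambda>_. t * t) :: complex^'n^'n)"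
    by (simp add: vec_eq_iff real_diag_matrix_mult_nth)
  moreover have "(t * t) powr s = t powr (2 * s)"
    using assms by (simp add: powr_mult flip: powr_add)
  ultimately show ?thesis
    using assms by (simp add: Lambda_def mat_powr_real_diag trace_def)
qed

text \<open>On scalar matrices with \<open>K\<close> and \<open>M\<close> the identity, the function
  is a multiple of \<open>t powr (2 * s)\<close>. Comparing its value at 1 with those at
  \<open>\<epsilon>\<close> and \<open>2 - \<epsilon>\<close>, with \<open>\<epsilon>\<close>
  tending to 0, gives \<open>2 \<le> 2 powr (2 * s)\<close>.\<close>

lemma convex_imp_outer_exponent:
  assumes "s > 0"
    and conv: "\<And>K M :: complex^'n^'n. invertible K \<Longrightarrow> M \<in> pos_def_mats \<Longrightarrow>
      convex_on pos_def_mats (\<lambda>A. Lambda 1 s A K M)"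
  shows "s \<ge> 1/2"
proof (rule ccontr)
  assume s: "\<not> s \<ge> 1/2"
  have I: "(mat 1 :: complex^'n^'n) = real_diag (\<lambda>_. 1)" by (simp add: vec_eq_iff mat_def)
  have pd: "(mat 1 :: complex^'n^'n) \<in> pos_def_mats"
    unfolding I by (rule real_diag_pos_def) simp
  have c: "convex_on pos_def_mats (\<lambda>A :: complex^'n^'n. Lambda 1 s A (mat 1) (mat 1))"
    by (rule conv[OF pos_def_invertible[OF pd] pd])
  have le: "1 \<le> (1/2) * \<epsilon> powr (2 * s) + (1/2) * (2 - \<epsilon>) powr (2 * s)" if "0 < \<epsilon>" "\<epsilon> < 1" for \<epsilon>
  proof -
    have "Lambda 1 s ((1/2) *\<^sub>R real_diag (\<lambda>_. \<epsilon>) + (1/2) *\<^sub>R real_diag (\<lambda>_. 2 - \<epsilon>)) (mat 1) (mat 1 :: complex^'n^'n)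
      \<le> (1/2) * Lambda 1 s (real_diag (\<lambda>_. \<epsilon>)) (mat 1) (mat 1 :: complex^'n^'n)
        + (1/2) * Lambda 1 s (real_diag (\<lambda>_. 2 - \<epsilon>)) (mat 1) (mat 1 :: complex^'n^'n)"
      by (rule c[unfolded convex_on_def, THEN conjunct2, rule_format])
        (use that in \<open>auto intro!: real_diag_pos_def\<close>)
    moreover have "\<epsilon> / 2 + (2 - \<epsilon>) / 2 = 1" by (simp add: field_simps)
    ultimately have "real CARD('n) * 1 \<le> real CARD('n) * ((1/2) * \<epsilon> powr (2 * s) + (1/2) * (2 - \<epsilon>) powr (2 * s))"
      using that by (simp add: real_diag_combination Lambda_scalar algebra_simps)
    then show ?thesis by (subst (asm) mult_le_cancel_left_pos) auto
  qed
  have "((\<lambda>\<epsilon>. (1/2) * \<epsilon> powr (2 * s) + (1/2) * (2 - \<epsilon>) powr (2 * s))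
      \<longlongrightarrow> (1/2) * 0 powr (2 * s) + (1/2) * (2 - 0) powr (2 * s)) (at_right (0::real))"
    using assms(1) by (intro tendsto_intros tendsto_powr') (auto simp: eventually_at_filter)
  moreover have "eventually (\<lambda>\<epsilon>. 1 \<le> (1/2) * \<epsilon> powr (2 * s) + (1/2) * (2 - \<epsilon>) powr (2 * s)) (at_right (0::real))"
    using le by (auto simp: eventually_at_right_field intro!: exI[of _ 1])
  ultimately have "1 \<le> (1/2) * 0 powr (2 * s) + (1/2) * (2 - 0) powr (2 * s)"
    by (intro tendsto_lowerbound) auto
  moreover have "(2::real) powr (2 * s) < 2" using powr_less_mono[of "2 * s" 1 2] s by simp
  ultimately show False by simp
qed

theorem theorem3p1:
  fixes r s :: real
  assumes "CARD('n::finite) \<ge> 2" and "r \<noteq> 0" and "s > 0"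
  shows "((\<forall>K M :: complex^'n^'n. invertible K \<longrightarrow> M \<in> pos_def_mats \<longrightarrow>
              convex_on pos_def_mats (\<lambda>A. Lambda r s A K M))
            \<longleftrightarrow> r = 1 \<and> s \<ge> 1/2)
       \<and> \<not> (\<forall>K M :: complex^'n^'n. invertible K \<longrightarrow> M \<in> pos_def_mats \<longrightarrow>
              concave_on pos_def_mats (\<lambda>A. Lambda r s A K M))"
proof (intro conjI iffI)
  assume conv: "\<forall>K M :: complex^'n^'n. invertible K \<longrightarrow> M \<in> pos_def_mats \<longrightarrow>
    convex_on pos_def_mats (\<lambda>A. Lambda r s A K M)"
  have "r \<ge> 0"
    by (rule convex_imp_nonneg_exponent[OF assms(1,3)]) (use conv in blast)
  then show r: "r = 1"
    using convex_imp_exponent_1[OF assms(1,3)] conv assms(2) by fastforce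
  show "s \<ge> 1/2"
    by (rule convex_imp_outer_exponent[OF assms(3)]) (use conv r in blast)
next
  assume "r = 1 \<and> s \<ge> 1/2"
  then show "\<forall>K M :: complex^'n^'n. invertible K \<longrightarrow> M \<in> pos_def_mats \<longrightarrow>
    convex_on pos_def_mats (\<lambda>A. Lambda r s A K M)"
    using Lambda_1_convex by blast
next
  show "\<not> (\<forall>K M :: complex^'n^'n. invertible K \<longrightarrow> M \<in> pos_def_mats \<longrightarrow>
    concave_on pos_def_mats (\<lambda>A. Lambda r s A K M))"
    by (rule Lambda_not_concave[OF assms])
qed

end
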